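(* Let $A$ be a Banach algebra, $X$ a Banach $A$-bimodule and $D:A\to X^*$ a surjective derivation. Suppose that $D'':A^{**}\to X^{***}$ is also a derivation. Then for every $x''\in X^{**}$ the mapping $a''\mapsto x''a''$ from $A^{**}$ into $X^{**}$ is weak$^*$-to-weak continuous.
   Context: A derivation $D:B\to Y$ from a Banach algebra $B$ into a Banach $B$-bimodule $Y$ is a bounded linear map with $D(xy)=xD(y)+D(x)y$ for all $x,y\in B$. $D''$ denotes the second adjoint of $D$. If $Y$ is a Banach $B$-bimodule, $Y^*$ is the dual $B$-bimodule: $\langle y'b,y\rangle=\langle y',by\rangle$, $\langle by',y\rangle=\langle y',yb\rangle$. $A^{**}$ carries the first Arens product: $\langle a'a,b\rangle=\langle a',ab\rangle$, $\langle a''a',a\rangle=\langle a'',a'a\rangle$, $\langle a''b'',a'\rangle=\langle a'',b''a'\rangle$. $X^{**}$ is a Banach $A^{**}$-bimodule with $a''x''=w^*\text{-}\lim_\alpha\lim_\beta a_\alpha x_\beta$ and $x''a''=w^*\text{-}\lim_\beta\lim_\alpha x_\beta a_\alpha$ whenever $(a_\alpha)\subseteq A$, $(x_\beta)\subseteq X$ are bounded nets converging weak$^*$ to $a''$, $x''$. $X^{***}=(X^{**})^*$ is the dual $A^{**}$-bimodule of $X^{**}$. The weak$^*$ topology on $A^{**}$ is $\sigma(A^{**},A^* )$ and the weak topology on $X^{**}$ is $\sigma(X^{**},X^{***})$. *)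

theory Defs
  imports "HOL-Analysis.Analysis" "HOL-Library.Function_Algebras"
begin

section \<open>Scalars\<close>

text \<open>
  The scalar field is \<open>\<real>\<close> or \<open>\<complex>\<close>. Working over an abstract type of this class covers real and
  complex Banach algebras simultaneously.
\<close>

class real_or_complex = real_normed_field +
  assumes real_or_complex:
    "(\<forall>z. \<exists>a. z = a *\<^sub>R 1) \<or> (\<exists>i. i * i = - 1 \<and> (\<forall>z. \<exists>a b. z = a *\<^sub>R 1 + b *\<^sub>R i))"

instance real :: real_or_complex
  by standard auto

instance complex :: real_or_complex
proof
  have "\<exists>a b. z = a *\<^sub>R 1 + b *\<^sub>R \<i>" for z
    by (rule exI[of _ "Re z"], rule exI[of _ "Im z"]) (simp add: complex_eq_iff)
  then show "(\<forall>z::complex. \<exists>a. z = a *\<^sub>R 1) \<or>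
      (\<exists>i::complex. i * i = - 1 \<and> (\<forall>z. \<exists>a b. z = a *\<^sub>R 1 + b *\<^sub>R i))"
    by (intro disjI2 exI[of _ \<i>]) auto
qed


section \<open>Normed and Banach spaces\<close>

text \<open>
  A space is a linear subspace \<open>pts\<close> of an ambient vector space, with a norm that matters only on
  \<open>pts\<close>. Dual spaces over an arbitrary scalar type are sets of functions, and are therefore
  available only in this form.
\<close>

record ('k, 'v) space =
  pts :: "'v set"
  scl :: "'k \<Rightarrow> 'v \<Rightarrow> 'v"
  nrm :: "'v \<Rightarrow> real"

definition normed_space :: "('k::real_or_complex, 'v::ab_group_add) space \<Rightarrow> bool" where
  "normed_space E \<longleftrightarrow>
     vector_space (scl E) \<and> module.subspace (scl E) (pts E) \<and>
     (\<forall>x\<in>pts E. 0 \<le> nrm E x \<and> (nrm E x = 0 \<longleftrightarrow> x = 0)) \<and>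
     (\<forall>c. \<forall>x\<in>pts E. nrm E (scl E c x) = norm c * nrm E x) \<and>
     (\<forall>x\<in>pts E. \<forall>y\<in>pts E. nrm E (x + y) \<le> nrm E x + nrm E y)"

definition banach_space :: "('k::real_or_complex, 'v::ab_group_add) space \<Rightarrow> bool" where
  "banach_space E \<longleftrightarrow> normed_space E \<and>
     (\<forall>u::nat \<Rightarrow> 'v. (\<forall>n. u n \<in> pts E) \<and>
         (\<forall>e>0. \<exists>N. \<forall>m\<ge>N. \<forall>n\<ge>N. nrm E (u m - u n) < e) \<longrightarrow>
       (\<exists>x\<in>pts E. (\<lambda>n. nrm E (u n - x)) \<longlonglongrightarrow> 0))"

definition bounded_linear_map ::
  "('k::real_or_complex, 'v::ab_group_add) space \<Rightarrow> ('k, 'w::ab_group_add) space \<Rightarrow> ('v \<Rightarrow> 'w) \<Rightarrow> bool"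
where
  "bounded_linear_map E F T \<longleftrightarrow>
     (\<forall>x\<in>pts E. T x \<in> pts F) \<and>
     (\<forall>x\<in>pts E. \<forall>y\<in>pts E. T (x + y) = T x + T y) \<and>
     (\<forall>c. \<forall>x\<in>pts E. T (scl E c x) = scl F c (T x)) \<and>
     (\<exists>M. \<forall>x\<in>pts E. nrm F (T x) \<le> M * nrm E x)"

definition bounded_bilinear_map ::
  "('k::real_or_complex, 'u::ab_group_add) space \<Rightarrow> ('k, 'v::ab_group_add) space \<Rightarrow>
   ('k, 'w::ab_group_add) space \<Rightarrow> ('u \<Rightarrow> 'v \<Rightarrow> 'w) \<Rightarrow> bool"
where
  "bounded_bilinear_map E F G b \<longleftrightarrow>
     (\<forall>x\<in>pts E. \<forall>y\<in>pts F. b x y \<in> pts G) \<and>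
     (\<forall>x\<in>pts E. \<forall>x'\<in>pts E. \<forall>y\<in>pts F. b (x + x') y = b x y + b x' y) \<and>
     (\<forall>x\<in>pts E. \<forall>y\<in>pts F. \<forall>y'\<in>pts F. b x (y + y') = b x y + b x y') \<and>
     (\<forall>c. \<forall>x\<in>pts E. \<forall>y\<in>pts F.
        b (scl E c x) y = scl G c (b x y) \<and> b x (scl F c y) = scl G c (b x y)) \<and>
     (\<exists>M. \<forall>x\<in>pts E. \<forall>y\<in>pts F. nrm G (b x y) \<le> M * nrm E x * nrm F y)"


section \<open>Duals, adjoints and weak topologies\<close>

definition scalars :: "('k::real_or_complex, 'k) space" where
  "scalars = \<lparr>pts = UNIV, scl = (*), nrm = norm\<rparr>"

text \<open>
  A functional on \<open>pts E\<close> is represented by its extension by \<open>0\<close> to the ambient type; the value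
  \<open>0\<close> (rather than \<open>undefined\<close>) makes the dual closed under the pointwise operations.
\<close>

definition dual :: "('k::real_or_complex, 'v::ab_group_add) space \<Rightarrow> ('k, 'v \<Rightarrow> 'k) space" where
  "dual E = \<lparr>pts = {f. bounded_linear_map E scalars f \<and> (\<forall>x. x \<notin> pts E \<longrightarrow> f x = 0)},
             scl = (\<lambda>c f x. c * f x),
             nrm = (\<lambda>f. Sup {norm (f x) | x. x \<in> pts E \<and> nrm E x \<le> 1})\<rparr>"

abbreviation bidual ::
  "('k::real_or_complex, 'v::ab_group_add) space \<Rightarrow> ('k, ('v \<Rightarrow> 'k) \<Rightarrow> 'k) space" where
  "bidual E \<equiv> dual (dual E)"

definition zero_ext :: "('k, 'v) space \<Rightarrow> ('v \<Rightarrow> 'k::zero) \<Rightarrow> 'v \<Rightarrow> 'k" where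
  "zero_ext E f = (\<lambda>x. if x \<in> pts E then f x else 0)"

text \<open>The canonical embedding of \<open>E\<close> into its bidual.\<close>

definition evaluation ::
  "('k::real_or_complex, 'v::ab_group_add) space \<Rightarrow> 'v \<Rightarrow> ('v \<Rightarrow> 'k) \<Rightarrow> 'k" where
  "evaluation E x = zero_ext (dual E) (\<lambda>f. f x)"

text \<open>
  For \<open>T : E \<rightarrow> F\<close>, the map \<open>adjoint_map E T : F\<^sup>* \<rightarrow> E\<^sup>*\<close>, so that the second adjoint is
  \<open>second_adjoint E F T : E\<^sup>*\<^sup>* \<rightarrow> F\<^sup>*\<^sup>*\<close>.
\<close>

definition adjoint_map ::
  "('k::real_or_complex, 'v) space \<Rightarrow> ('v \<Rightarrow> 'w) \<Rightarrow> ('w \<Rightarrow> 'k) \<Rightarrow> ('v \<Rightarrow> 'k)" where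
  "adjoint_map E T g = zero_ext E (\<lambda>x. g (T x))"

definition second_adjoint ::
  "('k::real_or_complex, 'v::ab_group_add) space \<Rightarrow> ('k, 'w::ab_group_add) space \<Rightarrow> ('v \<Rightarrow> 'w) \<Rightarrow>
   (('v \<Rightarrow> 'k) \<Rightarrow> 'k) \<Rightarrow> (('w \<Rightarrow> 'k) \<Rightarrow> 'k)" where
  "second_adjoint E F T = adjoint_map (dual F) (adjoint_map E T)"

text \<open>\<open>weak_topology E\<close> is \<open>\<sigma>(E, E\<^sup>*)\<close> on \<open>E\<close>; \<open>weak_star_topology E\<close> is \<open>\<sigma>(E\<^sup>*, E)\<close> on \<open>E\<^sup>*\<close>.\<close>

definition weak_topology :: "('k::real_or_complex, 'v::ab_group_add) space \<Rightarrow> 'v topology" where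
  "weak_topology E =
     topology_generated_by {{x \<in> pts E. f x \<in> U} | f U. f \<in> pts (dual E) \<and> open U}"

definition weak_star_topology ::
  "('k::real_or_complex, 'v::ab_group_add) space \<Rightarrow> ('v \<Rightarrow> 'k) topology" where
  "weak_star_topology E =
     topology_generated_by {{f \<in> pts (dual E). f x \<in> U} | x U. x \<in> pts E \<and> open U}"


section \<open>Banach algebras, bimodules, derivations\<close>

definition banach_algebra ::
  "('k::real_or_complex, 'a::ab_group_add) space \<Rightarrow> ('a \<Rightarrow> 'a \<Rightarrow> 'a) \<Rightarrow> bool" where
  "banach_algebra A m \<longleftrightarrow> banach_space A \<and> bounded_bilinear_map A A A m \<and>
     (\<forall>a\<in>pts A. \<forall>b\<in>pts A. \<forall>c\<in>pts A. m (m a b) c = m a (m b c)) \<and>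
     (\<forall>a\<in>pts A. \<forall>b\<in>pts A. nrm A (m a b) \<le> nrm A a * nrm A b)"

text \<open>\<open>l a x\<close> is \<open>a x\<close> and \<open>r x a\<close> is \<open>x a\<close>.\<close>

definition banach_bimodule ::
  "('k::real_or_complex, 'a::ab_group_add) space \<Rightarrow> ('a \<Rightarrow> 'a \<Rightarrow> 'a) \<Rightarrow>
   ('k, 'x::ab_group_add) space \<Rightarrow> ('a \<Rightarrow> 'x \<Rightarrow> 'x) \<Rightarrow> ('x \<Rightarrow> 'a \<Rightarrow> 'x) \<Rightarrow> bool" where
  "banach_bimodule A m X l r \<longleftrightarrow> banach_space X \<and>
     bounded_bilinear_map A X X l \<and> bounded_bilinear_map X A X r \<and>
     (\<forall>a\<in>pts A. \<forall>b\<in>pts A. \<forall>x\<in>pts X.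
        l (m a b) x = l a (l b x) \<and> r x (m a b) = r (r x a) b \<and> r (l a x) b = l a (r x b))"

text \<open>The two actions on \<open>Y\<^sup>*\<close>; the left action comes from the right action on \<open>Y\<close> and vice versa.\<close>

definition dual_left ::
  "('k::real_or_complex, 'y) space \<Rightarrow> ('y \<Rightarrow> 'b \<Rightarrow> 'y) \<Rightarrow> 'b \<Rightarrow> ('y \<Rightarrow> 'k) \<Rightarrow> ('y \<Rightarrow> 'k)" where
  "dual_left Y r b f = zero_ext Y (\<lambda>y. f (r y b))"

definition dual_right ::
  "('k::real_or_complex, 'y) space \<Rightarrow> ('b \<Rightarrow> 'y \<Rightarrow> 'y) \<Rightarrow> ('y \<Rightarrow> 'k) \<Rightarrow> 'b \<Rightarrow> ('y \<Rightarrow> 'k)" where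
  "dual_right Y l f b = zero_ext Y (\<lambda>y. f (l b y))"

definition derivation ::
  "('k::real_or_complex, 'b::ab_group_add) space \<Rightarrow> ('b \<Rightarrow> 'b \<Rightarrow> 'b) \<Rightarrow>
   ('k, 'y::ab_group_add) space \<Rightarrow> ('b \<Rightarrow> 'y \<Rightarrow> 'y) \<Rightarrow> ('y \<Rightarrow> 'b \<Rightarrow> 'y) \<Rightarrow> ('b \<Rightarrow> 'y) \<Rightarrow> bool" where
  "derivation B m Y l r D \<longleftrightarrow> bounded_linear_map B Y D \<and>
     (\<forall>x\<in>pts B. \<forall>y\<in>pts B. D (m x y) = l x (D y) + r (D x) y)"


section \<open>The first Arens product and the bimodule structure of the bidual\<close>

text \<open>
  \<open>arens1 A m f a\<close> is \<open>a' a\<close>, \<open>arens2 A m \<phi> f\<close> is \<open>a'' a'\<close> and \<open>arens A m \<phi> \<psi>\<close> is \<open>a'' b''\<close>.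
\<close>

definition arens1 ::
  "('k::real_or_complex, 'a::ab_group_add) space \<Rightarrow> ('a \<Rightarrow> 'a \<Rightarrow> 'a) \<Rightarrow> ('a \<Rightarrow> 'k) \<Rightarrow> 'a \<Rightarrow> ('a \<Rightarrow> 'k)" where
  "arens1 A m f a = zero_ext A (\<lambda>b. f (m a b))"

definition arens2 ::
  "('k::real_or_complex, 'a::ab_group_add) space \<Rightarrow> ('a \<Rightarrow> 'a \<Rightarrow> 'a) \<Rightarrow>
   (('a \<Rightarrow> 'k) \<Rightarrow> 'k) \<Rightarrow> ('a \<Rightarrow> 'k) \<Rightarrow> ('a \<Rightarrow> 'k)" where
  "arens2 A m \<phi> f = zero_ext A (\<lambda>a. \<phi> (arens1 A m f a))"

definition arens ::
  "('k::real_or_complex, 'a::ab_group_add) space \<Rightarrow> ('a \<Rightarrow> 'a \<Rightarrow> 'a) \<Rightarrow>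
   (('a \<Rightarrow> 'k) \<Rightarrow> 'k) \<Rightarrow> (('a \<Rightarrow> 'k) \<Rightarrow> 'k) \<Rightarrow> (('a \<Rightarrow> 'k) \<Rightarrow> 'k)" where
  "arens A m \<phi> \<psi> = zero_ext (dual A) (\<lambda>f. \<phi> (arens2 A m \<psi> f))"

text \<open>
  A bounded net in \<open>E\<close> converging weak* to \<open>\<phi>\<close>. A net enters only through the filter generated by
  the images of its tails, and every proper filter containing a bounded set arises in this way, so
  nets are represented by filters.
\<close>

definition bounded_net_to ::
  "('k::real_or_complex, 'v::ab_group_add) space \<Rightarrow> 'v filter \<Rightarrow> (('v \<Rightarrow> 'k) \<Rightarrow> 'k) \<Rightarrow> bool" where
  "bounded_net_to E F \<phi> \<longleftrightarrow> F \<noteq> bot \<and> (\<exists>C. \<forall>\<^sub>F x in F. x \<in> pts E \<and> nrm E x \<le> C) \<and>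
     limitin (weak_star_topology (dual E)) (evaluation E) \<phi> F"

text \<open>
  \<open>w\<^sup>*-lim\<^sub>s lim\<^sub>t b s t = \<xi>\<close> in \<open>X\<^sup>*\<^sup>*\<close>, for \<open>b s t\<close> in \<open>X\<close>; the inner limits \<open>y s\<close> are again weak*
  limits in \<open>X\<^sup>*\<^sup>*\<close>.
\<close>

definition iterated_limit ::
  "('k::real_or_complex, 'x::ab_group_add) space \<Rightarrow> ('s \<Rightarrow> 't \<Rightarrow> 'x) \<Rightarrow> 's filter \<Rightarrow> 't filter \<Rightarrow>
   (('x \<Rightarrow> 'k) \<Rightarrow> 'k) \<Rightarrow> bool" where
  "iterated_limit X b F G \<xi> \<longleftrightarrow>
     (\<exists>y. (\<forall>\<^sub>F s in F. limitin (weak_star_topology (dual X)) (\<lambda>t. evaluation X (b s t)) (y s) G) \<and>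
          limitin (weak_star_topology (dual X)) y \<xi> F)"

text \<open>
  \<open>L\<close>, \<open>R\<close> are the left and right actions making \<open>X\<^sup>*\<^sup>*\<close> a Banach \<open>A\<^sup>*\<^sup>*\<close>-bimodule. Every element of a
  bidual is the weak* limit of a bounded net (Goldstine), so the limit conditions determine \<open>L\<close> and
  \<open>R\<close> on the biduals.
\<close>

definition bidual_bimodule ::
  "('k::real_or_complex, 'a::ab_group_add) space \<Rightarrow> ('a \<Rightarrow> 'a \<Rightarrow> 'a) \<Rightarrow>
   ('k, 'x::ab_group_add) space \<Rightarrow> ('a \<Rightarrow> 'x \<Rightarrow> 'x) \<Rightarrow> ('x \<Rightarrow> 'a \<Rightarrow> 'x) \<Rightarrow>
   ((('a \<Rightarrow> 'k) \<Rightarrow> 'k) \<Rightarrow> (('x \<Rightarrow> 'k) \<Rightarrow> 'k) \<Rightarrow> (('x \<Rightarrow> 'k) \<Rightarrow> 'k)) \<Rightarrow>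
   ((('x \<Rightarrow> 'k) \<Rightarrow> 'k) \<Rightarrow> (('a \<Rightarrow> 'k) \<Rightarrow> 'k) \<Rightarrow> (('x \<Rightarrow> 'k) \<Rightarrow> 'k)) \<Rightarrow> bool" where
  "bidual_bimodule A m X l r L R \<longleftrightarrow>
     banach_bimodule (bidual A) (arens A m) (bidual X) L R \<and>
     (\<forall>\<phi>\<in>pts (bidual A). \<forall>\<xi>\<in>pts (bidual X). \<forall>F G.
        bounded_net_to A F \<phi> \<and> bounded_net_to X G \<xi> \<longrightarrow>
          iterated_limit X (\<lambda>a x. l a x) F G (L \<phi> \<xi>) \<and>
          iterated_limit X (\<lambda>x a. r x a) G F (R \<xi> \<phi>))"

end

theory Submission
  imports Defs
begin

text \<open>
  Write \<open>D'\<close> and \<open>D''\<close> for the first and second adjoint of \<open>D\<close>, and fix \<open>\<xi>\<close> in \<open>X\<^sup>*\<^sup>*\<close>. Evaluating the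
  derivation identity \<open>D''(\<phi> \<psi>) = \<phi> D''(\<psi>) + D''(\<phi>) \<psi>\<close> at \<open>\<xi>\<close> and solving for the middle term gives
  \<open>\<langle>D''(\<psi>), \<xi> \<phi>\<rangle> = \<langle>\<phi> \<psi>, D'(\<xi>)\<rangle> - \<langle>\<phi>, D'(\<psi> \<xi>)\<rangle>\<close>.
  On the right the second term is the value of \<open>\<phi>\<close> at an element of \<open>A\<^sup>*\<close>. So is the first, because for
  the first Arens product \<open>\<langle>\<phi> \<psi>, f\<rangle> = \<langle>\<phi>, \<psi> f\<rangle>\<close> with \<open>\<psi> f\<close> in \<open>A\<^sup>*\<close> (lemma \<open>arens2_mem\<close>). Hence
  \<open>\<phi> \<mapsto> \<langle>\<Lambda>, \<xi> \<phi>\<rangle>\<close> is weak* continuous for every \<open>\<Lambda>\<close> in the range of \<open>D''\<close>; it remains to see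
  that this range is all of \<open>X\<^sup>*\<^sup>*\<^sup>*\<close>.

  This is where surjectivity of \<open>D\<close> enters: the second adjoint of an operator onto a Banach space is
  onto (lemma \<open>second_adjoint_surj\<close>). The dual \<open>X\<^sup>*\<close> is complete, so the uniform boundedness principle
  shows that \<open>D'\<close> is bounded below (lemma \<open>adjoint_map_bounded_below\<close>); a functional \<open>\<Lambda>\<close> on \<open>X\<^sup>*\<^sup>*\<close>
  therefore induces a bounded functional on the range of \<open>D'\<close>, which extends to \<open>A\<^sup>*\<close> by the
  Hahn--Banach theorem.
\<close>

section \<open>The scalar field\<close>

text \<open>
  The norm is only assumed multiplicative, so it need not be the Euclidean one a priori. Comparing
  the norms of \<open>a + b i\<close> and of its conjugate, whose product is \<open>a\<^sup>2 + b\<^sup>2\<close>, still shows that real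
  parts are bounded.
\<close>

lemma real_part_le_norm:
  fixes i :: "'k::real_normed_field"
  assumes "i * i = - 1"
  shows "\<bar>a\<bar> \<le> 2 * norm (of_real a + of_real b * i)"
proof (cases "\<bar>a\<bar> + \<bar>b\<bar> = 0")
  case False
  have "norm i * norm i = 1"
    using assms by (metis norm_minus_cancel norm_mult norm_one)
  then have ni: "norm i = 1"
    by (metis norm_ge_zero abs_of_nonneg abs_square_eq_1 power2_eq_square)
  have "(of_real a + of_real b * i) * (of_real a - of_real b * i)
      = of_real (a * a) - of_real (b * b) * (i * i)"
    by (simp add: algebra_simps)
  also have "\<dots> = of_real (a * a + b * b)"
    by (simp add: assms)
  finally have "norm (of_real a + of_real b * i) * norm (of_real a - of_real b * i)
      = norm (of_real (a * a + b * b) :: 'k)"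
    by (metis norm_mult)
  also have "\<dots> = a * a + b * b"
    unfolding norm_of_real by simp
  finally have e: "a * a + b * b
      = norm (of_real a + of_real b * i) * norm (of_real a - of_real b * i)" ..
  have "norm (of_real a - of_real b * i) \<le> \<bar>a\<bar> + \<bar>b\<bar>"
    using norm_triangle_ineq4[of "of_real a" "of_real b * i"] by (simp add: norm_mult ni)
  then have "a * a + b * b \<le> norm (of_real a + of_real b * i) * (\<bar>a\<bar> + \<bar>b\<bar>)"
    unfolding e by (simp add: mult_left_mono)
  then have "2 * (a * a + b * b) \<le> (2 * norm (of_real a + of_real b * i)) * (\<bar>a\<bar> + \<bar>b\<bar>)"
    by (simp only: mult.assoc mult_le_cancel_left_pos zero_less_numeral)
  moreover have "(\<bar>a\<bar> + \<bar>b\<bar>) * (\<bar>a\<bar> + \<bar>b\<bar>) \<le> 2 * (a * a + b * b)"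
    using zero_le_square[of "\<bar>a\<bar> - \<bar>b\<bar>"] by (simp add: algebra_simps)
  ultimately have "(\<bar>a\<bar> + \<bar>b\<bar>) * (\<bar>a\<bar> + \<bar>b\<bar>)
      \<le> (2 * norm (of_real a + of_real b * i)) * (\<bar>a\<bar> + \<bar>b\<bar>)"
    by (rule order_trans[rotated])
  moreover have "\<bar>a\<bar> + \<bar>b\<bar> > 0"
    using False by linarith
  ultimately have "\<bar>a\<bar> + \<bar>b\<bar> \<le> 2 * norm (of_real a + of_real b * i)"
    by (simp only: mult_le_cancel_right)
  then show ?thesis by linarith
next
  case True
  then have "a = 0" by linarith
  then show ?thesis by simp
qed

text \<open>
  A real part \<open>re\<close> and an imaginary unit \<open>i\<close>, with \<open>i = 0\<close> for real scalars. With this convention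
  the identity \<open>z = re z - i re (i z)\<close>, which recovers a scalar from real parts alone, covers both
  fields, and the arguments below need no distinction between them.
\<close>

lemma real_part_exists:
  obtains i :: "'k::real_or_complex" and re :: "'k \<Rightarrow> real"
  where "i = 0 \<or> i * i = - 1"
    and "\<And>z w. re (z + w) = re z + re w"
    and "\<And>a z. re (of_real a * z) = a * re z"
    and "\<And>z. \<bar>re z\<bar> \<le> 2 * norm z"
    and "\<And>z. z = of_real (re z) - i * of_real (re (i * z))"
proof -
  consider "\<forall>z::'k. \<exists>a. z = a *\<^sub>R 1"
    | i :: 'k where "i * i = - 1" "\<forall>z. \<exists>a b. z = a *\<^sub>R 1 + b *\<^sub>R i"
    using real_or_complex by blast
  then show thesis
  proof cases
    case 1
    then obtain re :: "'k \<Rightarrow> real" where re: "\<And>z. z = of_real (re z)"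
      unfolding of_real_def by metis
    have re': "re (of_real a) = a" for a
      by (metis re of_real_eq_iff)
    show thesis
    proof (rule that[of 0 re])
      show "re (z + w) = re z + re w" for z w
        by (metis re re' of_real_add)
      show "re (of_real a * z) = a * re z" for a z
        by (metis re re' of_real_mult)
      show "\<bar>re z\<bar> \<le> 2 * norm z" for z
        using re[of z] norm_of_real[of "re z", where 'a='k] by simp
    qed (use re in auto)
  next
    case (2 i)
    then obtain re im :: "'k \<Rightarrow> real" where z: "\<And>z. z = of_real (re z) + of_real (im z) * i"
      unfolding scaleR_conv_of_real by (metis mult.right_neutral)
    have uniq: "re z = a" if "z = of_real a + of_real b * i" for z a b
    proof -
      have "of_real (re z - a) + of_real (im z - b) * i = 0"
        using z[of z] that by (simp add: algebra_simps)
      then show ?thesis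
        using real_part_le_norm[OF 2(1), of "re z - a" "im z - b"] by simp
    qed
    show thesis
    proof (rule that[of i re])
      show "re (v + w) = re v + re w" for v w
        by (rule uniq[where b = "im v + im w"], subst z[of v], subst z[of w])
           (simp add: algebra_simps)
      show "re (of_real a * w) = a * re w" for a w
        by (rule uniq[where b = "a * im w"], subst z[of w]) (simp add: algebra_simps)
      show "\<bar>re w\<bar> \<le> 2 * norm w" for w
        using real_part_le_norm[OF 2(1), of "re w" "im w"] z[of w] by simp
      have rei: "re (i * w) = - im w" for w
      proof (rule uniq[where b = "re w"])
        have "i * w = i * (of_real (re w) + of_real (im w) * i)"
          using z[of w] by simp
        also have "\<dots> = of_real (re w) * i + of_real (im w) * (i * i)"
          by (simp add: algebra_simps)
        finally show "i * w = of_real (- im w) + of_real (re w) * i"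
          by (simp add: 2(1))
      qed
      show "w = of_real (re w) - i * of_real (re (i * w))" for w
        by (rule trans[OF z]) (simp add: rei mult.commute[of _ i])
    qed (use 2 in auto)
  qed
qed

lemma scalars_complete:
  fixes z :: "nat \<Rightarrow> 'k::real_or_complex"
  assumes "Cauchy z"
  shows "convergent z"
proof -
  obtain i :: 'k and re :: "'k \<Rightarrow> real"
    where add: "\<And>z w. re (z + w) = re z + re w"
      and bound: "\<And>z. \<bar>re z\<bar> \<le> 2 * norm z"
      and decomp: "\<And>z. z = of_real (re z) - i * of_real (re (i * z))"
    using real_part_exists[where 'k = 'k] by metis
  have diff: "re (v - w) = re v - re w" for v w
    using add[of "v - w" w] by simp
  have conv: "convergent (\<lambda>n. re (y n))" if y: "Cauchy y" for y
  proof (rule real_Cauchy_convergent, rule CauchyI)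
    fix e :: real assume "e > 0"
    then obtain N where N: "\<And>m n. m \<ge> N \<Longrightarrow> n \<ge> N \<Longrightarrow> norm (y m - y n) < e / 2"
      using CauchyD[OF y, of "e / 2"] by (meson half_gt_zero)
    have "norm (re (y m) - re (y n)) < e" if "m \<ge> N" "n \<ge> N" for m n
      using bound[of "y m - y n"] N[OF that] by (simp add: diff)
    then show "\<exists>N. \<forall>m\<ge>N. \<forall>n\<ge>N. norm (re (y m) - re (y n)) < e"
      by blast
  qed
  have "Cauchy (\<lambda>n. i * z n)"
    using bounded_linear.Cauchy[OF bounded_linear_mult_right assms] .
  from conv[OF assms] conv[OF this] obtain a b
    where "(\<lambda>n. re (z n)) \<longlonglongrightarrow> a" "(\<lambda>n. re (i * z n)) \<longlonglongrightarrow> b"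
    unfolding convergent_def by blast
  then have "(\<lambda>n. of_real (re (z n)) - i * of_real (re (i * z n))) \<longlonglongrightarrow> of_real a - i * of_real b"
    by (intro tendsto_intros)
  then show ?thesis
    unfolding convergent_def decomp[symmetric] by blast
qed

section \<open>Normed spaces and their duals\<close>

lemma normed_space_vector_space: "normed_space E \<Longrightarrow> vector_space (scl E)"
  by (simp add: normed_space_def)

lemma normed_space_module: "normed_space E \<Longrightarrow> module (scl E)"
  by (simp add: normed_space_def module_iff_vector_space)

lemma normed_space_subspace: "normed_space E \<Longrightarrow> module.subspace (scl E) (pts E)"
  by (simp add: normed_space_def)

lemma zero_mem: "normed_space E \<Longrightarrow> 0 \<in> pts E"
  using module.subspace_0 normed_space_module normed_space_subspace by blast

lemma add_mem: "normed_space E \<Longrightarrow> x \<in> pts E \<Longrightarrow> y \<in> pts E \<Longrightarrow> x + y \<in> pts E"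
  using module.subspace_add normed_space_module normed_space_subspace by blast

lemma scl_mem: "normed_space E \<Longrightarrow> x \<in> pts E \<Longrightarrow> scl E c x \<in> pts E"
  using module.subspace_scale normed_space_module normed_space_subspace by blast

lemma diff_mem: "normed_space E \<Longrightarrow> x \<in> pts E \<Longrightarrow> y \<in> pts E \<Longrightarrow> x - y \<in> pts E"
  using module.subspace_diff normed_space_module normed_space_subspace by blast

lemma scl_minus_one: "normed_space E \<Longrightarrow> scl E (- 1) x = - x"
  using module.scale_minus_left[OF normed_space_module, of E 1 x]
    module.scale_one[OF normed_space_module, of E x] by simp

lemma nrm_nonneg: "normed_space E \<Longrightarrow> x \<in> pts E \<Longrightarrow> 0 \<le> nrm E x"
  by (simp add: normed_space_def)

lemma nrm_eq_0_iff: "normed_space E \<Longrightarrow> x \<in> pts E \<Longrightarrow> nrm E x = 0 \<longleftrightarrow> x = 0"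
  by (simp add: normed_space_def)

lemma nrm_scl: "normed_space E \<Longrightarrow> x \<in> pts E \<Longrightarrow> nrm E (scl E c x) = norm c * nrm E x"
  by (simp add: normed_space_def)

lemma nrm_triangle:
  "normed_space E \<Longrightarrow> x \<in> pts E \<Longrightarrow> y \<in> pts E \<Longrightarrow> nrm E (x + y) \<le> nrm E x + nrm E y"
  by (simp add: normed_space_def)

lemma nrm_uminus: "normed_space E \<Longrightarrow> x \<in> pts E \<Longrightarrow> nrm E (- x) = nrm E x"
  using nrm_scl[of E x "- 1"] by (simp add: scl_minus_one)

lemma dual_simps:
  "f \<in> pts (dual E) \<longleftrightarrow> bounded_linear_map E scalars f \<and> (\<forall>x. x \<notin> pts E \<longrightarrow> f x = 0)"
  "scl (dual E) = (\<lambda>c f x. c * f x)"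
  "nrm (dual E) f = Sup {norm (f x) | x. x \<in> pts E \<and> nrm E x \<le> 1}"
  by (simp_all add: dual_def)

lemma functional_add: "f \<in> pts (dual E) \<Longrightarrow> x \<in> pts E \<Longrightarrow> y \<in> pts E \<Longrightarrow> f (x + y) = f x + f y"
  by (simp add: dual_simps bounded_linear_map_def)

lemma functional_scl: "f \<in> pts (dual E) \<Longrightarrow> x \<in> pts E \<Longrightarrow> f (scl E c x) = c * f x"
  by (simp add: dual_simps bounded_linear_map_def scalars_def)

lemma functional_diff:
  assumes "normed_space E" "f \<in> pts (dual E)" "x \<in> pts E" "y \<in> pts E"
  shows "f (x - y) = f x - f y"
  using functional_add[OF assms(2) diff_mem[OF assms(1,3,4)] assms(4)] by simp

lemma dual_memI:
  assumes "\<And>x y. x \<in> pts E \<Longrightarrow> y \<in> pts E \<Longrightarrow> f (x + y) = f x + f y"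
    and "\<And>c x. x \<in> pts E \<Longrightarrow> f (scl E c x) = c * f x"
    and "\<And>x. x \<in> pts E \<Longrightarrow> norm (f x) \<le> M * nrm E x"
    and "\<And>x. x \<notin> pts E \<Longrightarrow> f x = 0"
  shows "f \<in> pts (dual E)"
  unfolding dual_simps bounded_linear_map_def scalars_def
  using assms by (auto intro!: exI[of _ M])

lemma functional_zero: "normed_space E \<Longrightarrow> f \<in> pts (dual E) \<Longrightarrow> f 0 = 0"
  using functional_diff[of E f 0 0] by (simp add: zero_mem)

lemma functional_bdd_above:
  assumes E: "normed_space E" and f: "f \<in> pts (dual E)"
  shows "bdd_above {norm (f x) | x. x \<in> pts E \<and> nrm E x \<le> 1}"
proof -
  have "\<exists>M. \<forall>x\<in>pts E. norm (f x) \<le> M * nrm E x"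
    using f by (simp add: dual_simps bounded_linear_map_def scalars_def)
  then obtain M where M: "\<And>x. x \<in> pts E \<Longrightarrow> norm (f x) \<le> M * nrm E x"
    by blast
  have "norm (f x) \<le> \<bar>M\<bar>" if "x \<in> pts E" "nrm E x \<le> 1" for x
  proof -
    have "M * nrm E x \<le> \<bar>M\<bar> * 1"
      by (intro mult_mono) (use that nrm_nonneg[OF E] in auto)
    then show ?thesis using M[OF that(1)] by simp
  qed
  then show ?thesis
    by (intro bdd_aboveI[where M = "\<bar>M\<bar>"]) auto
qed

lemma functional_le:
  assumes E: "normed_space E" and f: "f \<in> pts (dual E)" and x: "x \<in> pts E"
  shows "norm (f x) \<le> nrm (dual E) f * nrm E x"
proof (cases "x = 0")
  case True
  then show ?thesis
    using functional_zero[OF E f] nrm_eq_0_iff[OF E x] by simp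
next
  case False
  then have pos: "nrm E x > 0"
    using nrm_nonneg[OF E x] nrm_eq_0_iff[OF E x] by simp
  let ?c = "of_real (inverse (nrm E x)) :: 'a"
  have nc: "norm ?c = inverse (nrm E x)"
    unfolding norm_of_real using pos by simp
  have "nrm E (scl E ?c x) = 1"
    using nrm_scl[OF E x] nc pos by simp
  then have "norm (f (scl E ?c x)) \<in> {norm (f x) | x. x \<in> pts E \<and> nrm E x \<le> 1}"
    using scl_mem[OF E x] by (intro CollectI exI[of _ "scl E ?c x"]) simp
  then have "norm (f (scl E ?c x)) \<le> nrm (dual E) f"
    unfolding dual_simps(3) by (rule cSup_upper[OF _ functional_bdd_above[OF E f]])
  then have "inverse (nrm E x) * norm (f x) \<le> nrm (dual E) f"
    unfolding functional_scl[OF f x] norm_mult nc .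
  then show ?thesis
    using pos by (simp add: field_simps)
qed

lemma dual_nrm_le:
  assumes E: "normed_space E" and "0 \<le> M"
    and le: "\<And>x. x \<in> pts E \<Longrightarrow> norm (f x) \<le> M * nrm E x"
  shows "nrm (dual E) f \<le> M"
  unfolding dual_simps(3)
proof (rule cSup_least)
  show "{norm (f x) | x. x \<in> pts E \<and> nrm E x \<le> 1} \<noteq> {}"
    using zero_mem[OF E] nrm_eq_0_iff[OF E zero_mem[OF E]] by force
  show "y \<le> M" if "y \<in> {norm (f x) | x. x \<in> pts E \<and> nrm E x \<le> 1}" for y
  proof -
    obtain x where x: "y = norm (f x)" "x \<in> pts E" "nrm E x \<le> 1"
      using \<open>y \<in> _\<close> by blast
    have "M * nrm E x \<le> M * 1"
      using \<open>0 \<le> M\<close> x(3) by (intro mult_left_mono)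
    then show ?thesis using le[OF x(2)] x(1) by simp
  qed
qed

lemma normed_space_dual:
  assumes E: "normed_space E"
  shows "normed_space (dual E)"
proof -
  have vs: "vector_space (scl (dual E))"
    unfolding dual_simps by (rule vector_space.intro) (auto simp: fun_eq_iff algebra_simps)
  have zero: "0 \<in> pts (dual E)"
    by (rule dual_memI[where M = 0]) auto
  have add: "f + g \<in> pts (dual E)" if f: "f \<in> pts (dual E)" and g: "g \<in> pts (dual E)" for f g
  proof (rule dual_memI[where M = "nrm (dual E) f + nrm (dual E) g"])
    show "norm ((f + g) x) \<le> (nrm (dual E) f + nrm (dual E) g) * nrm E x" if "x \<in> pts E" for x
      using functional_le[OF E f that] functional_le[OF E g that]
        norm_triangle_ineq[of "f x" "g x"] by (simp add: algebra_simps)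
  qed (use f g in \<open>auto simp: functional_add functional_scl algebra_simps dual_simps(1)\<close>)
  have scl: "scl (dual E) c f \<in> pts (dual E)" if f: "f \<in> pts (dual E)" for c f
  proof (rule dual_memI[where M = "norm c * nrm (dual E) f"])
    show "norm (scl (dual E) c f x) \<le> norm c * nrm (dual E) f * nrm E x" if "x \<in> pts E" for x
      using functional_le[OF E f that]
      by (simp add: dual_simps(2) norm_mult mult.assoc mult_left_mono)
  qed (use f in \<open>auto simp: functional_add functional_scl algebra_simps dual_simps(1,2)\<close>)
  have nonneg: "0 \<le> nrm (dual E) f" if f: "f \<in> pts (dual E)" for f
  proof -
    have "norm (f 0) \<in> {norm (f x) | x. x \<in> pts E \<and> nrm E x \<le> 1}"
      using zero_mem[OF E] nrm_eq_0_iff[OF E zero_mem[OF E]]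
      by (intro CollectI exI[of _ 0]) simp
    then have "norm (f 0) \<le> nrm (dual E) f"
      unfolding dual_simps(3) by (rule cSup_upper[OF _ functional_bdd_above[OF E f]])
    then show ?thesis
      using norm_ge_zero order_trans by blast
  qed
  have null: "nrm (dual E) f = 0 \<longleftrightarrow> f = 0" if f: "f \<in> pts (dual E)" for f
  proof
    assume 0: "nrm (dual E) f = 0"
    show "f = 0"
    proof
      show "f x = 0 x" for x
        using functional_le[OF E f, of x] f 0 by (cases "x \<in> pts E") (auto simp: dual_simps(1))
    qed
  next
    assume "f = 0"
    then have "nrm (dual E) f \<le> 0"
      by (intro dual_nrm_le[OF E]) auto
    then show "nrm (dual E) f = 0"
      using nonneg[OF f] by simp
  qed
  have hom_le: "nrm (dual E) (scl (dual E) c f) \<le> norm c * nrm (dual E) f"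
    if f: "f \<in> pts (dual E)" for c f
    using functional_le[OF E f] nonneg[OF f]
    by (intro dual_nrm_le[OF E]) (simp_all add: dual_simps(2) norm_mult mult.assoc mult_left_mono)
  have hom: "nrm (dual E) (scl (dual E) c f) = norm c * nrm (dual E) f"
    if f: "f \<in> pts (dual E)" for c f
  proof (cases "c = 0")
    case True
    then have "scl (dual E) c f = 0"
      by (auto simp: dual_simps(2))
    then show ?thesis
      using True null[OF zero] by simp
  next
    case False
    \<comment> \<open>the reverse inequality is the direct one applied to \<open>inverse c\<close>\<close>
    have "scl (dual E) (inverse c) (scl (dual E) c f) = f"
      using False by (auto simp: dual_simps(2))
    then have "nrm (dual E) f \<le> norm (inverse c) * nrm (dual E) (scl (dual E) c f)"
      using hom_le[OF scl[OF f], of "inverse c" c] by simp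
    then have "norm c * nrm (dual E) f \<le> nrm (dual E) (scl (dual E) c f)"
      unfolding norm_inverse using False by (simp add: field_simps)
    then show ?thesis
      using hom_le[OF f, of c] by simp
  qed
  have tri: "nrm (dual E) (f + g) \<le> nrm (dual E) f + nrm (dual E) g"
    if f: "f \<in> pts (dual E)" and g: "g \<in> pts (dual E)" for f g
  proof (rule dual_nrm_le[OF E])
    show "norm ((f + g) x) \<le> (nrm (dual E) f + nrm (dual E) g) * nrm E x" if "x \<in> pts E" for x
      using functional_le[OF E f that] functional_le[OF E g that]
        norm_triangle_ineq[of "f x" "g x"] by (simp add: algebra_simps)
  qed (use nonneg f g in simp)
  have "module.subspace (scl (dual E)) (pts (dual E))"
    using vs zero add scl by (simp add: module.subspace_def module_iff_vector_space)
  then show ?thesis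
    unfolding normed_space_def using vs nonneg null hom tri by blast
qed

lemma banach_space_dual:
  assumes E: "normed_space E"
  shows "banach_space (dual E)"
  unfolding banach_space_def
proof (intro conjI allI impI)
  show dual: "normed_space (dual E)"
    using normed_space_dual[OF E] .
  fix u :: "nat \<Rightarrow> 'b \<Rightarrow> 'a"
  assume "(\<forall>n. u n \<in> pts (dual E)) \<and>
    (\<forall>e>0. \<exists>N. \<forall>m\<ge>N. \<forall>n\<ge>N. nrm (dual E) (u m - u n) < e)"
  then have u: "\<And>n. u n \<in> pts (dual E)"
    and cauchy: "\<And>e. e > 0 \<Longrightarrow> \<exists>N. \<forall>m\<ge>N. \<forall>n\<ge>N. nrm (dual E) (u m - u n) < e"
    by auto
  have diff_le: "norm (u m x - u n x) \<le> nrm (dual E) (u m - u n) * nrm E x" if "x \<in> pts E" for m n x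
    using functional_le[OF E diff_mem[OF dual u u] that] by simp
  have "convergent (\<lambda>n. u n x)" for x
  proof (cases "x \<in> pts E")
    case True
    show ?thesis
    proof (rule scalars_complete, rule CauchyI)
      fix e :: real assume "e > 0"
      have pos: "nrm E x + 1 > 0"
        using nrm_nonneg[OF E True] by simp
      then obtain N where N: "\<And>m n. m \<ge> N \<Longrightarrow> n \<ge> N \<Longrightarrow> nrm (dual E) (u m - u n) < e / (nrm E x + 1)"
        using cauchy[of "e / (nrm E x + 1)"] \<open>e > 0\<close> by auto
      have "norm (u m x - u n x) < e" if "m \<ge> N" "n \<ge> N" for m n
      proof -
        have "norm (u m x - u n x) \<le> nrm (dual E) (u m - u n) * (nrm E x + 1)"
          using diff_le[OF True, of m n] nrm_nonneg[OF dual diff_mem[OF dual u u], of m n]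
          by (simp add: algebra_simps)
        also have "\<dots> < e"
          using N[OF that] pos by (simp add: field_simps)
        finally show ?thesis .
      qed
      then show "\<exists>N. \<forall>m\<ge>N. \<forall>n\<ge>N. norm (u m x - u n x) < e"
        by blast
    qed
  next
    case False
    then show ?thesis
      using u by (simp add: dual_simps(1) convergent_const)
  qed
  then obtain f where f: "\<And>x. (\<lambda>n. u n x) \<longlonglongrightarrow> f x"
    unfolding convergent_def by metis
  have near: "norm (u m x - f x) \<le> e * nrm E x"
    if N: "\<And>m n. m \<ge> N \<Longrightarrow> n \<ge> N \<Longrightarrow> nrm (dual E) (u m - u n) < e" and "m \<ge> N" "x \<in> pts E"
    for e N m x
  proof (rule LIMSEQ_le_const2)
    show "(\<lambda>n. norm (u m x - u n x)) \<longlonglongrightarrow> norm (u m x - f x)"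
      by (intro tendsto_intros f)
    have "norm (u m x - u n x) \<le> e * nrm E x" if "n \<ge> N" for n
    proof -
      have "nrm (dual E) (u m - u n) * nrm E x \<le> e * nrm E x"
        using N[OF \<open>m \<ge> N\<close> that] nrm_nonneg[OF E \<open>x \<in> pts E\<close>] by (intro mult_right_mono) auto
      then show ?thesis
        using diff_le[OF \<open>x \<in> pts E\<close>, of m n] by simp
    qed
    then show "\<exists>N. \<forall>n\<ge>N. norm (u m x - u n x) \<le> e * nrm E x"
      by blast
  qed
  have "f \<in> pts (dual E)"
  proof -
    obtain N where N: "\<And>m n. m \<ge> N \<Longrightarrow> n \<ge> N \<Longrightarrow> nrm (dual E) (u m - u n) < 1"
      using cauchy[of 1] by auto
    show ?thesis
    proof (rule dual_memI[where M = "nrm (dual E) (u N) + 1"])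
      fix x y assume xy: "x \<in> pts E" "y \<in> pts E"
      have "(\<lambda>n. u n (x + y)) \<longlonglongrightarrow> f x + f y"
        using tendsto_add[OF f[of x] f[of y]] by (simp add: functional_add[OF u xy])
      then show "f (x + y) = f x + f y"
        using LIMSEQ_unique f by blast
    next
      fix c x assume x: "x \<in> pts E"
      have "(\<lambda>n. u n (scl E c x)) \<longlonglongrightarrow> c * f x"
        using tendsto_mult_left[OF f[of x]] by (simp add: functional_scl[OF u x])
      then show "f (scl E c x) = c * f x"
        using LIMSEQ_unique f by blast
    next
      fix x assume x: "x \<in> pts E"
      have "norm (u N x - f x) \<le> 1 * nrm E x"
        by (rule near[OF N]) (use x in auto)
      then show "norm (f x) \<le> (nrm (dual E) (u N) + 1) * nrm E x"
        using functional_le[OF E u x, of N]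
          norm_triangle_ineq4[of "u N x" "u N x - f x"] by (simp add: algebra_simps)
    next
      fix x assume "x \<notin> pts E"
      then show "f x = 0"
        using f[of x] u by (simp add: dual_simps(1) LIMSEQ_const_iff)
    qed
  qed
  moreover have "(\<lambda>n. nrm (dual E) (u n - f)) \<longlonglongrightarrow> 0"
  proof (rule LIMSEQ_I)
    fix e :: real assume "e > 0"
    then obtain N where N: "\<And>m n. m \<ge> N \<Longrightarrow> n \<ge> N \<Longrightarrow> nrm (dual E) (u m - u n) < e / 2"
      using cauchy[of "e / 2"] by auto
    have "norm (nrm (dual E) (u n - f) - 0) < e" if "n \<ge> N" for n
    proof -
      have "nrm (dual E) (u n - f) \<le> e / 2"
        using near[OF N that] \<open>e > 0\<close> by (intro dual_nrm_le[OF E]) simp_all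
      then show ?thesis
        using nrm_nonneg[OF dual diff_mem[OF dual u \<open>f \<in> _\<close>], of n] \<open>e > 0\<close> by simp
    qed
    then show "\<exists>N. \<forall>n\<ge>N. norm (nrm (dual E) (u n - f) - 0) < e"
      by blast
  qed
  ultimately show "\<exists>f\<in>pts (dual E). (\<lambda>n. nrm (dual E) (u n - f)) \<longlonglongrightarrow> 0"
    by blast
qed

section \<open>Uniform boundedness\<close>

text \<open>
  The supremum of \<open>\<bar>f\<bar>\<close> over a ball of radius \<open>r\<close> is at least \<open>\<parallel>f\<parallel> r\<close>, wherever the centre lies: if
  \<open>f w\<close> is large, one of \<open>f (x + w)\<close> and \<open>f (x - w)\<close> is, since they differ by \<open>2 f w\<close>.
\<close>

lemma functional_large_near:
  assumes E: "normed_space E" and f: "f \<in> pts (dual E)"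
    and K: "0 \<le> K" "K < nrm (dual E) f" and x: "x \<in> pts E" and r: "0 \<le> r"
  obtains y where "y \<in> pts E" "nrm E (y - x) \<le> r" "K * r \<le> norm (f y)"
proof -
  obtain z where z: "z \<in> pts E" "norm (f z) > K * nrm E z"
    using dual_nrm_le[OF E K(1), of f] K(2) by force
  have "nrm E z \<noteq> 0"
    using z functional_zero[OF E f] nrm_eq_0_iff[OF E z(1)] by auto
  then have pos: "nrm E z > 0"
    using nrm_nonneg[OF E z(1)] by simp
  define w where "w = scl E (of_real (r / nrm E z)) z"
  have w: "w \<in> pts E"
    unfolding w_def by (rule scl_mem[OF E z(1)])
  have nc: "norm (of_real (r / nrm E z) :: 'a) = r / nrm E z"
    unfolding norm_of_real using pos r by simp
  have nw: "nrm E w = r"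
    unfolding w_def using nrm_scl[OF E z(1)] nc pos by simp
  have "norm (f w) = r / nrm E z * norm (f z)"
    unfolding w_def functional_scl[OF f z(1)] norm_mult nc ..
  also have "\<dots> \<ge> r / nrm E z * (K * nrm E z)"
    using z(2) r pos by (intro mult_left_mono) auto
  finally have fw: "norm (f w) \<ge> K * r"
    using pos by (simp add: mult.commute)
  have "f (x + w) - f (x - w) = f w + f w"
    using functional_add[OF f x w] functional_diff[OF E f x w] by simp
  then have "norm (f w + f w) \<le> norm (f (x + w)) + norm (f (x - w))"
    by (metis norm_triangle_ineq4)
  moreover have "norm (f w + f w) = 2 * norm (f w)"
    by (metis mult_2 norm_mult norm_numeral)
  ultimately consider "K * r \<le> norm (f (x + w))" | "K * r \<le> norm (f (x - w))"
    using fw by linarith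
  then show thesis
  proof cases
    case 1
    then show thesis
      using that[of "x + w"] add_mem[OF E x w] nw by simp
  next
    case 2
    then show thesis
      using that[of "x - w"] diff_mem[OF E x w] nw nrm_uminus[OF E w] by simp
  qed
qed

text \<open>
  Gliding hump: if \<open>f\<^sub>n\<close> has norm above \<open>4\<^sup>n\<close>, walk by steps of length at most \<open>3\<^sup>-\<^sup>n\<close>, at step \<open>n\<close>
  to a point where \<open>f\<^sub>n\<close> is at least \<open>2/3\<close> of its norm times \<open>3\<^sup>-\<^sup>n\<close>. All later steps together have length at
  most half of \<open>3\<^sup>-\<^sup>n\<close>, so at the limit \<open>f\<^sub>n\<close> keeps at least \<open>1/6\<close> of its norm times \<open>3\<^sup>-\<^sup>n\<close>, which exceeds
  \<open>(4/3)\<^sup>n / 6\<close>.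
\<close>

lemma uniform_boundedness:
  assumes E: "banach_space E" and S: "S \<subseteq> pts (dual E)"
    and pointwise: "\<And>x. x \<in> pts E \<Longrightarrow> \<exists>C. \<forall>f\<in>S. norm (f x) \<le> C"
  shows "\<exists>C. \<forall>f\<in>S. nrm (dual E) f \<le> C"
proof (rule ccontr)
  have E': "normed_space E"
    using E by (simp add: banach_space_def)
  assume "\<not> ?thesis"
  then have "\<forall>n::nat. \<exists>f. f \<in> S \<and> nrm (dual E) f > 4 ^ n"
    by (meson not_le)
  then obtain f where f: "\<And>n::nat. f n \<in> S" "\<And>n. nrm (dual E) (f n) > 4 ^ n"
    by metis
  have fd: "f n \<in> pts (dual E)" for n
    using f(1) S by blast
  have fpos: "nrm (dual E) (f n) > 0" for n
    by (rule less_trans[OF _ f(2)]) simp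
  \<comment> \<open>the step lengths of the walk\<close>
  define q :: "nat \<Rightarrow> real" where "q n = (1/3) ^ n" for n
  have q_pos: "q n > 0" and q_Suc: "q (Suc n) = q n / 3" and q_4: "4 ^ n * q n = (4/3) ^ n" for n
    by (simp_all add: q_def flip: power_mult_distrib)
  let ?Q = "\<lambda>n x y. nrm E (y - x) \<le> q n \<and> 2 / 3 * nrm (dual E) (f n) * q n \<le> norm (f n y)"
  have "\<exists>u. \<forall>n. u n \<in> pts E \<and> ?Q n (u n) (u (Suc n))"
  proof (rule dependent_nat_choice)
    show "\<exists>x. x \<in> pts E"
      using zero_mem[OF E'] by blast
    show "\<exists>y. y \<in> pts E \<and> ?Q n x y" if "x \<in> pts E" for x n
    proof (rule functional_large_near[OF E' fd _ _ that])
      show "0 \<le> 2 / 3 * nrm (dual E) (f n)" "2 / 3 * nrm (dual E) (f n) < nrm (dual E) (f n)"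
        using fpos[of n] by simp_all
      show "0 \<le> q n"
        using q_pos[of n] by simp
    qed blast
  qed
  then obtain u where u: "\<And>n. u n \<in> pts E"
    and step: "\<And>n. nrm E (u (Suc n) - u n) \<le> q n"
    and large: "\<And>n. 2 / 3 * nrm (dual E) (f n) * q n \<le> norm (f n (u (Suc n)))"
    by blast
  have tri: "nrm E (x - z) \<le> nrm E (x - y) + nrm E (y - z)"
    if "x \<in> pts E" "y \<in> pts E" "z \<in> pts E" for x y z
    using nrm_triangle[OF E' diff_mem[OF E' that(1,2)] diff_mem[OF E' that(2,3)]] by simp
  have swap: "nrm E (x - y) = nrm E (y - x)" if "x \<in> pts E" "y \<in> pts E" for x y
    using nrm_uminus[OF E' diff_mem[OF E' that]] by simp
  have tail: "nrm E (u (n + k) - u n) \<le> 3 / 2 * (q n - q (n + k))" for n k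
  proof (induction k)
    case 0
    then show ?case
      using nrm_eq_0_iff[OF E' zero_mem[OF E']] by simp
  next
    case (Suc k)
    have "nrm E (u (Suc (n + k)) - u n) \<le> 3 / 2 * (q n - q (Suc (n + k)))"
      using tri[OF u u u, of "Suc (n + k)" n "n + k"] step[of "n + k"] Suc q_Suc[of "n + k"]
      by argo
    then show ?case by simp
  qed
  have tail': "nrm E (u m - u n) \<le> 3 / 2 * q n" if "m \<ge> n" for m n
    using tail[of n "m - n"] that q_pos[of m] by simp
  have "\<exists>N. \<forall>m\<ge>N. \<forall>n\<ge>N. nrm E (u m - u n) < e" if "e > 0" for e
  proof -
    obtain N where N: "q N < e / 3"
      using real_arch_pow_inv[of "e / 3" "1/3"] \<open>e > 0\<close> unfolding q_def by auto
    have "nrm E (u m - u n) < e" if "m \<ge> N" "n \<ge> N" for m n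
      using tri[OF u u u, of m n N] tail'[OF that(1)] tail'[OF that(2)]
        swap[OF u u, of N n] N by linarith
    then show ?thesis by blast
  qed
  with u have "\<exists>x\<in>pts E. (\<lambda>n. nrm E (u n - x)) \<longlonglongrightarrow> 0"
    using E by (simp add: banach_space_def)
  then obtain x where x: "x \<in> pts E" "(\<lambda>n. nrm E (u n - x)) \<longlonglongrightarrow> 0"
    by blast
  have lim: "nrm E (x - u n) \<le> 3 / 2 * q n" for n
  proof (rule LIMSEQ_le_const)
    show "(\<lambda>m. nrm E (u m - x) + 3 / 2 * q n) \<longlonglongrightarrow> 3 / 2 * q n"
      using tendsto_add[OF x(2) tendsto_const] by simp
    have "nrm E (x - u n) \<le> nrm E (u m - x) + 3 / 2 * q n" if "m \<ge> n" for m
      using tri[OF x(1) u u, of n m] tail'[OF that] swap[OF x(1) u, of m] by linarith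
    then show "\<exists>N. \<forall>m\<ge>N. nrm E (x - u n) \<le> nrm E (u m - x) + 3 / 2 * q n"
      by blast
  qed
  have grow: "(4/3) ^ n / 6 \<le> norm (f n x)" for n
  proof -
    let ?N = "nrm (dual E) (f n)"
    have "norm (f n (x - u (Suc n))) \<le> ?N * nrm E (x - u (Suc n))"
      using functional_le[OF E' fd diff_mem[OF E' x(1) u]] .
    also have "\<dots> \<le> ?N * (3 / 2 * q (Suc n))"
      using lim[of "Suc n"] fpos[of n] by (intro mult_left_mono) auto
    also have "\<dots> = 1 / 2 * (?N * q n)"
      by (simp add: q_Suc)
    finally have "norm (f n (x - u (Suc n))) \<le> 1 / 2 * (?N * q n)" .
    moreover have "norm (f n (u (Suc n))) \<le> norm (f n x) + norm (f n (x - u (Suc n)))"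
      using functional_diff[OF E' fd x(1) u, of n "Suc n"]
        norm_triangle_ineq4[of "f n x" "f n (x - u (Suc n))"] by simp
    moreover have "2 / 3 * (?N * q n) \<le> norm (f n (u (Suc n)))"
      using large[of n] by (simp only: mult.assoc)
    moreover have "4 ^ n * q n \<le> ?N * q n"
      using f(2)[of n] q_pos[of n] by (intro mult_right_mono) auto
    ultimately show ?thesis
      unfolding q_4 by linarith
  qed
  obtain C where C: "\<And>g. g \<in> S \<Longrightarrow> norm (g x) \<le> C"
    using pointwise[OF x(1)] by blast
  obtain n where "(4/3::real) ^ n > 6 * C"
    using real_arch_pow[of "4/3" "6 * C"] by auto
  then show False
    using grow[of n] C[OF f(1), of n] by linarith
qed

section \<open>The Hahn--Banach theorem\<close>

text \<open>
  Partially defined functionals are handled as linear relations. If such a relation is dominated by a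
  seminorm \<open>p\<close> in the sense that \<open>t \<le> p x\<close> for its pairs \<open>(x, t)\<close>, it is automatically single-valued,
  because it relates \<open>0\<close> to no \<open>t \<noteq> 0\<close>; and unions of chains cause no well-definedness problem.
\<close>

definition linear_graph ::
  "('k::field \<Rightarrow> 'v::ab_group_add \<Rightarrow> 'v) \<Rightarrow> ('v \<times> 'k) set \<Rightarrow> bool" where
  "linear_graph s G \<longleftrightarrow> (0, 0) \<in> G \<and>
     (\<forall>x t y u. (x, t) \<in> G \<and> (y, u) \<in> G \<longrightarrow> (x + y, t + u) \<in> G) \<and>
     (\<forall>c x t. (x, t) \<in> G \<longrightarrow> (s c x, c * t) \<in> G)"

text \<open>
  The one-dimensional extension step. The value \<open>c\<close> at \<open>w\<close> has to satisfy
  \<open>u - p (z - w) \<le> c \<le> p (y + w) - t\<close> for all pairs \<open>(z, u)\<close> and \<open>(y, t)\<close> of the relation; subadditivity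
  of \<open>p\<close> leaves room for it.
\<close>

lemma dominated_graph_extend:
  fixes s :: "real \<Rightarrow> 'v::ab_group_add \<Rightarrow> 'v"
  assumes vs: "vector_space s" and W: "module.subspace s W"
    and p_add: "\<And>x y. x \<in> W \<Longrightarrow> y \<in> W \<Longrightarrow> p (x + y) \<le> p x + p y"
    and p_scl: "\<And>c x. x \<in> W \<Longrightarrow> p (s c x) = \<bar>c\<bar> * p x"
    and H: "linear_graph s H" and dom: "\<And>x t. (x, t) \<in> H \<Longrightarrow> x \<in> W \<and> t \<le> p x"
    and w: "w \<in> W"
  obtains H' where "linear_graph s H'" "\<And>x t. (x, t) \<in> H' \<Longrightarrow> x \<in> W \<and> t \<le> p x"
    "H \<subseteq> H'" "w \<in> fst ` H'"
proof -
  interpret vector_space s by (rule vs)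
  have H0: "(0, 0) \<in> H"
    and Hadd: "\<And>x t y u. (x, t) \<in> H \<Longrightarrow> (y, u) \<in> H \<Longrightarrow> (x + y, t + u) \<in> H"
    and Hscl: "\<And>c x t. (x, t) \<in> H \<Longrightarrow> (s c x, c * t) \<in> H"
    using H by (auto simp: linear_graph_def)
  have gap: "u - p (z - w) \<le> p (y + w) - t" if "(y, t) \<in> H" "(z, u) \<in> H" for y t z u
  proof -
    have "t + u \<le> p (y + z)"
      using dom[OF Hadd[OF that]] by simp
    also have "\<dots> = p ((y + w) + (z - w))"
      by simp
    also have "\<dots> \<le> p (y + w) + p (z - w)"
      using dom[OF that(1)] dom[OF that(2)] w W
      by (intro p_add subspace_add subspace_diff) auto
    finally show ?thesis by simp
  qed
  define c where "c = Sup {u - p (z - w) | z u. (z, u) \<in> H}"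
  have lower: "u - p (z - w) \<le> c" if "(z, u) \<in> H" for z u
    unfolding c_def using that gap[OF H0]
    by (intro cSup_upper bdd_aboveI[where M = "p (0 + w) - 0"]) auto
  have upper: "c \<le> p (y + w) - t" if "(y, t) \<in> H" for y t
    unfolding c_def using H0 gap[OF that] by (intro cSup_least) auto
  define H' where "H' = {(y + s a w, t + a * c) | y t a. (y, t) \<in> H}"
  have mem: "(y + s a w, t + a * c) \<in> H'" if "(y, t) \<in> H" for y t a
    unfolding H'_def using that by blast
  show thesis
  proof (rule that[of H'])
    show "H \<subseteq> H'"
      using mem[of _ _ 0] by auto
    show "w \<in> fst ` H'"
      using mem[OF H0, of 1] by force
    show "linear_graph s H'"
      unfolding linear_graph_def
    proof (intro conjI allI impI)
      show "(0, 0) \<in> H'"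
        using mem[OF H0, of 0] by simp
    next
      fix x t y u assume "(x, t) \<in> H' \<and> (y, u) \<in> H'"
      then obtain x' t' a y' u' b
        where "x = x' + s a w" "t = t' + a * c" "(x', t') \<in> H"
          "y = y' + s b w" "u = u' + b * c" "(y', u') \<in> H"
        unfolding H'_def by blast
      then show "(x + y, t + u) \<in> H'"
        using mem[OF Hadd[of x' t' y' u'], of "a + b"] by (simp add: algebra_simps)
    next
      fix b x t assume "(x, t) \<in> H'"
      then obtain x' t' a where "x = x' + s a w" "t = t' + a * c" "(x', t') \<in> H"
        unfolding H'_def by blast
      then show "(s b x, b * t) \<in> H'"
        using mem[OF Hscl[of x' t' b], of "b * a"] by (simp add: algebra_simps)
    qed
  next
    fix x v assume "(x, v) \<in> H'"
    then obtain y t a where x: "x = y + s a w" and v: "v = t + a * c" and yt: "(y, t) \<in> H"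
      unfolding H'_def by blast
    have yW: "y \<in> W"
      using dom[OF yt] by simp
    have "v \<le> p x"
    proof (cases "a = 0")
      case True
      then show ?thesis
        using dom[OF yt] x v by simp
    next
      case False
      \<comment> \<open>by homogeneity only \<open>a = 1\<close> and \<open>a = - 1\<close> matter, and these are the two bounds on \<open>c\<close>\<close>
      let ?b = "inverse \<bar>a\<bar>"
      have "t / \<bar>a\<bar> + sgn a * c \<le> p (s ?b y + s (sgn a) w)"
      proof (cases "a > 0")
        case True
        then have "sgn a = 1" by simp
        then show ?thesis
          using upper[OF Hscl[OF yt, of ?b]] by (simp add: divide_inverse mult.commute)
      next
        case neg: False
        then have "sgn a = - 1"
          using False by simp
        then show ?thesis
          using lower[OF Hscl[OF yt, of ?b]] by (simp add: divide_inverse mult.commute)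
      qed
      also have "s ?b y + s (sgn a) w = s ?b x"
        unfolding x using False by (simp add: scale_right_distrib sgn_if field_simps)
      also have "p (s ?b x) = p x / \<bar>a\<bar>"
        unfolding x using p_scl[of "y + s a w" ?b] yW w W
        by (simp add: subspace_add subspace_scale field_simps)
      finally have "\<bar>a\<bar> * (t / \<bar>a\<bar> + sgn a * c) \<le> \<bar>a\<bar> * (p x / \<bar>a\<bar>)"
        by (intro mult_left_mono) auto
      moreover have "\<bar>a\<bar> * (t / \<bar>a\<bar> + sgn a * c) = v"
        unfolding v using False by (simp add: distrib_left sgn_if)
      ultimately show ?thesis
        using False by simp
    qed
    then show "x \<in> W \<and> v \<le> p x"
      unfolding x using yW w W by (simp add: subspace_add subspace_scale)
  qed
qed

lemma hahn_banach_real: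
  fixes s :: "real \<Rightarrow> 'v::ab_group_add \<Rightarrow> 'v"
  assumes vs: "vector_space s" and W: "module.subspace s W"
    and p_add: "\<And>x y. x \<in> W \<Longrightarrow> y \<in> W \<Longrightarrow> p (x + y) \<le> p x + p y"
    and p_scl: "\<And>c x. x \<in> W \<Longrightarrow> p (s c x) = \<bar>c\<bar> * p x"
    and G: "linear_graph s G" and dom: "\<And>x t. (x, t) \<in> G \<Longrightarrow> x \<in> W \<and> t \<le> p x"
  obtains u where "\<And>x y. x \<in> W \<Longrightarrow> y \<in> W \<Longrightarrow> u (x + y) = u x + u y"
    and "\<And>c x. x \<in> W \<Longrightarrow> u (s c x) = c * u x"
    and "\<And>x. x \<in> W \<Longrightarrow> \<bar>u x\<bar> \<le> p x"
    and "\<And>x t. (x, t) \<in> G \<Longrightarrow> u x = t"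
proof -
  interpret vector_space s by (rule vs)
  let ?P = "\<lambda>H. linear_graph s H \<and> (\<forall>x t. (x, t) \<in> H \<longrightarrow> x \<in> W \<and> t \<le> p x)"
  define \<A> where "\<A> = {H. G \<subseteq> H \<and> ?P H}"
  have "\<exists>M\<in>\<A>. \<forall>H\<in>\<A>. M \<subseteq> H \<longrightarrow> H = M"
  proof (rule subset_Zorn_nonempty)
    have "G \<in> \<A>"
      using G dom unfolding \<A>_def by blast
    then show "\<A> \<noteq> {}" by blast
    fix C assume "C \<noteq> {}" and "subset.chain \<A> C"
    then have C: "\<And>H. H \<in> C \<Longrightarrow> G \<subseteq> H \<and> ?P H"
      and chain: "\<And>H K. H \<in> C \<Longrightarrow> K \<in> C \<Longrightarrow> H \<subseteq> K \<or> K \<subseteq> H"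
      unfolding subset_chain_def \<A>_def by blast+
    have zero: "(0, 0) \<in> H"
      and add: "(x, t) \<in> H \<Longrightarrow> (y, v) \<in> H \<Longrightarrow> (x + y, t + v) \<in> H"
      and scl: "(x, t) \<in> H \<Longrightarrow> (s c x, c * t) \<in> H"
      if "H \<in> C" for H x t y v c
      using C[OF that] by (simp_all add: linear_graph_def)
    obtain K where K: "K \<in> C"
      using \<open>C \<noteq> {}\<close> by blast
    have "linear_graph s (\<Union> C)"
      unfolding linear_graph_def
    proof (intro conjI allI impI)
      show "(0, 0) \<in> \<Union> C"
        using zero[OF K] K by blast
      show "(x + y, t + v) \<in> \<Union> C" if xy: "(x, t) \<in> \<Union> C \<and> (y, v) \<in> \<Union> C" for x t y v
      proof -
        obtain H H' where "H \<in> C" "(x, t) \<in> H" "H' \<in> C" "(y, v) \<in> H'"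
          using xy by blast
        then obtain H'' where "H'' \<in> C" "(x, t) \<in> H''" "(y, v) \<in> H''"
          using chain[of H H'] by blast
        then show ?thesis
          using add by blast
      qed
      show "(s c x, c * t) \<in> \<Union> C" if "(x, t) \<in> \<Union> C" for c x t
        using that scl by blast
    qed
    moreover have "G \<subseteq> \<Union> C"
      using C[OF K] K by blast
    moreover have "\<forall>x t. (x, t) \<in> \<Union> C \<longrightarrow> x \<in> W \<and> t \<le> p x"
      using C by (meson UnionE)
    ultimately show "\<Union> C \<in> \<A>"
      unfolding \<A>_def by simp
  qed
  then obtain H where "H \<in> \<A>" and maximal: "\<And>K. K \<in> \<A> \<Longrightarrow> H \<subseteq> K \<Longrightarrow> K = H"
    by blast
  then have GH: "G \<subseteq> H" and H: "linear_graph s H"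
    and Hdom: "\<And>x t. (x, t) \<in> H \<Longrightarrow> x \<in> W \<and> t \<le> p x"
    unfolding \<A>_def by auto
  have H0: "(0, 0) \<in> H"
    and Hadd: "\<And>x t y u. (x, t) \<in> H \<Longrightarrow> (y, u) \<in> H \<Longrightarrow> (x + y, t + u) \<in> H"
    and Hscl: "\<And>c x t. (x, t) \<in> H \<Longrightarrow> (s c x, c * t) \<in> H"
    using H by (auto simp: linear_graph_def)
  have total: "\<exists>t. (w, t) \<in> H" if w: "w \<in> W" for w
  proof -
    obtain K where "linear_graph s K" "\<And>x t. (x, t) \<in> K \<Longrightarrow> x \<in> W \<and> t \<le> p x"
      "H \<subseteq> K" "w \<in> fst ` K"
    proof (rule dominated_graph_extend[where p = p, OF vs W p_add p_scl H Hdom w])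
      fix K assume "linear_graph s K" "\<And>x t. (x, t) \<in> K \<Longrightarrow> x \<in> W \<and> t \<le> p x"
        "H \<subseteq> K" "w \<in> fst ` K"
      then show thesis by (rule that)
    qed
    moreover from this GH have "K \<in> \<A>"
      unfolding \<A>_def by blast
    ultimately show ?thesis
      using maximal[of K] by auto
  qed
  have p0: "p 0 = 0"
    using p_scl[of 0 0] subspace_0[OF W] by simp
  have uniq: "t = u" if "(x, t) \<in> H" "(x, u) \<in> H" for x t u
  proof -
    have "(0, t - u) \<in> H" "(0, u - t) \<in> H"
      using Hadd[OF that(1) Hscl[OF that(2), of "- 1"]] Hadd[OF that(2) Hscl[OF that(1), of "- 1"]]
      by simp_all
    then show ?thesis
      using Hdom[of 0 "t - u"] Hdom[of 0 "u - t"] p0 by simp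
  qed
  have "\<forall>x. \<exists>t. x \<in> W \<longrightarrow> (x, t) \<in> H"
    using total by blast
  from choice[OF this] obtain u where u: "\<And>x. x \<in> W \<Longrightarrow> (x, u x) \<in> H"
    by blast
  show thesis
  proof (rule that[of u])
    show "u (x + y) = u x + u y" if "x \<in> W" "y \<in> W" for x y
      using uniq[OF u[OF subspace_add[OF W that]] Hadd[OF u[OF that(1)] u[OF that(2)]]] .
    show "u (s c x) = c * u x" if "x \<in> W" for c x
      using uniq[OF u[OF subspace_scale[OF W that]] Hscl[OF u[OF that]]] .
    show "\<bar>u x\<bar> \<le> p x" if "x \<in> W" for x
      using Hdom[OF u[OF that]] Hdom[OF Hscl[OF u[OF that], of "- 1"]] p_scl[OF that, of "- 1"]
      by (simp add: abs_le_iff)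
    show "u x = t" if "(x, t) \<in> G" for x t
      using uniq[OF u subsetD[OF GH that]] dom[OF that] by simp
  qed
qed

text \<open>
  The complex case follows the usual reduction: extend the real part to a real-linear \<open>u\<close> and put
  \<open>f x = u x - i u (i x)\<close>. Only boundedness of the extension is claimed: the triangle inequality gives
  it directly, whereas equality of norms would need a rotation of the scalars.
\<close>

lemma hahn_banach:
  fixes E :: "('k::real_or_complex, 'v::ab_group_add) space"
  assumes E: "normed_space E" and G: "linear_graph (scl E) G" and "0 \<le> M"
    and dom: "\<And>x t. (x, t) \<in> G \<Longrightarrow> x \<in> pts E \<and> norm t \<le> M * nrm E x"
  obtains f where "f \<in> pts (dual E)" and "\<And>x t. (x, t) \<in> G \<Longrightarrow> f x = t"
proof -
  interpret vector_space "scl E" by (rule normed_space_vector_space[OF E])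
  obtain i :: 'k and re :: "'k \<Rightarrow> real"
    where i: "i = 0 \<or> i * i = - 1"
      and re_add: "\<And>z w. re (z + w) = re z + re w"
      and re_scl: "\<And>a z. re (of_real a * z) = a * re z"
      and re_le: "\<And>z. \<bar>re z\<bar> \<le> 2 * norm z"
      and decomp: "\<And>z. z = of_real (re z) - i * of_real (re (i * z))"
    by (rule real_part_exists[where 'k = 'k]) (rule that)
  define s where "s = (\<lambda>a. scl E (of_real a))"
  have vs: "vector_space s"
    unfolding s_def
    by (rule vector_space.intro) (simp_all add: scale_right_distrib scale_left_distrib)
  have W: "module.subspace s (pts E)"
    using vs zero_mem[OF E] add_mem[OF E] scl_mem[OF E]
    by (intro module.subspaceI) (simp_all add: module_iff_vector_space s_def)
  have G0: "(0, 0) \<in> G"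
    and Gadd: "\<And>x t y u. (x, t) \<in> G \<Longrightarrow> (y, u) \<in> G \<Longrightarrow> (x + y, t + u) \<in> G"
    and Gscl: "\<And>c x t. (x, t) \<in> G \<Longrightarrow> (scl E c x, c * t) \<in> G"
    using G by (auto simp: linear_graph_def)
  have re0: "re 0 = 0"
    using re_scl[of 0 0] by simp
  define p where "p = (\<lambda>x. 2 * M * nrm E x)"
  define G' where "G' = {(x, re t) | x t. (x, t) \<in> G}"
  obtain u where u_add: "\<And>x y. x \<in> pts E \<Longrightarrow> y \<in> pts E \<Longrightarrow> u (x + y) = u x + u y"
    and u_scl: "\<And>c x. x \<in> pts E \<Longrightarrow> u (s c x) = c * u x"
    and u_le: "\<And>x. x \<in> pts E \<Longrightarrow> \<bar>u x\<bar> \<le> p x"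
    and u_ext: "\<And>x t. (x, t) \<in> G' \<Longrightarrow> u x = t"
  proof (rule hahn_banach_real[OF vs W, of p G'])
    show "p (x + y) \<le> p x + p y" if "x \<in> pts E" "y \<in> pts E" for x y
      using mult_left_mono[OF nrm_triangle[OF E that], of "2 * M"] \<open>0 \<le> M\<close>
      by (simp add: p_def algebra_simps)
    show "p (s c x) = \<bar>c\<bar> * p x" if "x \<in> pts E" for c x
      unfolding p_def s_def nrm_scl[OF E that] norm_of_real by simp
    show "linear_graph s G'"
      unfolding linear_graph_def
    proof (intro conjI allI impI)
      show "(0, 0) \<in> G'"
        unfolding G'_def using G0 re0 by (intro CollectI exI[of _ 0]) simp
      show "(x + y, t + u) \<in> G'" if xy: "(x, t) \<in> G' \<and> (y, u) \<in> G'" for x t y u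
      proof -
        obtain z w where "(x, z) \<in> G" "t = re z" "(y, w) \<in> G" "u = re w"
          using xy unfolding G'_def by blast
        then show ?thesis
          unfolding G'_def using Gadd[of x z y w] re_add[of z w]
          by (intro CollectI exI[of _ "x + y"] exI[of _ "z + w"]) simp
      qed
      show "(s c x, c * t) \<in> G'" if xt: "(x, t) \<in> G'" for c x t
      proof -
        obtain z where "(x, z) \<in> G" "t = re z"
          using xt unfolding G'_def by blast
        then show ?thesis
          unfolding G'_def s_def using Gscl[of x z "of_real c"] re_scl[of c z]
          by (intro CollectI exI[of _ "scl E (of_real c) x"] exI[of _ "of_real c * z"]) simp
      qed
    qed
    show "x \<in> pts E \<and> t \<le> p x" if xt: "(x, t) \<in> G'" for x t
    proof -
      obtain z where z: "(x, z) \<in> G" "t = re z"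
        using xt unfolding G'_def by blast
      then show ?thesis
        using re_le[of z] dom[OF z(1)] unfolding p_def mult.assoc by auto
    qed
  qed (rule that)
  define f where "f = zero_ext E (\<lambda>x. of_real (u x) - i * of_real (u (scl E i x)))"
  have f: "f x = of_real (u x) - i * of_real (u (scl E i x))" if "x \<in> pts E" for x
    using that by (simp add: f_def zero_ext_def)
  have f_add: "f (x + y) = f x + f y" if "x \<in> pts E" "y \<in> pts E" for x y
    using that by (simp add: f add_mem[OF E] scl_mem[OF E] scale_right_distrib u_add algebra_simps)
  have f_real: "f (scl E (of_real a) x) = of_real a * f x" if x: "x \<in> pts E" for a x
  proof -
    have "u (scl E (of_real a) x) = a * u x"
      using u_scl[OF x, of a] by (simp add: s_def)
    moreover have "u (scl E i (scl E (of_real a) x)) = a * u (scl E i x)"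
      using u_scl[OF scl_mem[OF E x, of i], of a] by (simp add: s_def mult.commute)
    ultimately show ?thesis
      using x by (simp add: f scl_mem[OF E] algebra_simps)
  qed
  have u0: "u 0 = 0"
    using u_scl[of 0 0] zero_mem[OF E] by (simp add: s_def)
  have f_i: "f (scl E i x) = i * f x" if x: "x \<in> pts E" for x
    using i
  proof
    assume "i = 0"
    then show ?thesis
      using x u0 by (simp add: f scl_mem[OF E] zero_mem[OF E])
  next
    assume ii: "i * i = - 1"
    have "u (- x) = - u x"
      using u_scl[OF x, of "- 1"] by (simp add: s_def)
    then have "f (scl E i x) = of_real (u (scl E i x)) + i * of_real (u x)"
      using x by (simp add: f scl_mem[OF E] ii)
    moreover have "i * f x = i * of_real (u x) - (i * i) * of_real (u (scl E i x))"
      unfolding f[OF x] right_diff_distrib mult.assoc ..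
    ultimately show ?thesis
      by (simp add: ii)
  qed
  show thesis
  proof (rule that[of f])
    show "f x = t" if "(x, t) \<in> G" for x t
    proof -
      have "u x = re t" "u (scl E i x) = re (i * t)"
        using that Gscl[OF that, of i] by (auto intro!: u_ext simp: G'_def)
      then show ?thesis
        using f dom[OF that] decomp[of t] by simp
    qed
    show "f \<in> pts (dual E)"
    proof (rule dual_memI[where M = "2 * M + norm i * (2 * M * norm i)"])
      show "f (x + y) = f x + f y" if "x \<in> pts E" "y \<in> pts E" for x y
        using f_add[OF that] .
      show "f (scl E c x) = c * f x" if x: "x \<in> pts E" for c x
      proof -
        define a b where "a = re c" and "b = - re (i * c)"
        have c: "c = of_real a + of_real b * i"
          using decomp[of c] by (simp add: a_def b_def mult.commute)
        have "f (scl E c x) = f (scl E (of_real a) x + scl E (of_real b) (scl E i x))"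
          unfolding c by (simp add: scale_left_distrib)
        also have "\<dots> = of_real a * f x + of_real b * (i * f x)"
          using x by (simp add: f_add f_real f_i scl_mem[OF E] del: scale_scale)
        also have "\<dots> = c * f x"
          unfolding c by (simp add: algebra_simps)
        finally show ?thesis .
      qed
      show "norm (f x) \<le> (2 * M + norm i * (2 * M * norm i)) * nrm E x" if x: "x \<in> pts E" for x
      proof -
        have "norm (f x) \<le> norm (of_real (u x) :: 'k) + norm (i * of_real (u (scl E i x)))"
          unfolding f[OF x] by (rule norm_triangle_ineq4)
        also have "\<dots> = \<bar>u x\<bar> + norm i * \<bar>u (scl E i x)\<bar>"
          by (simp add: norm_mult)
        also have "\<dots> \<le> p x + norm i * p (scl E i x)"
          using u_le x scl_mem[OF E x] by (intro add_mono mult_left_mono) auto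
        also have "\<dots> = (2 * M + norm i * (2 * M * norm i)) * nrm E x"
          unfolding p_def nrm_scl[OF E x] by (simp add: algebra_simps)
        finally show ?thesis .
      qed
    qed (simp add: f_def zero_ext_def)
  qed
qed

section \<open>Second adjoints of surjective operators\<close>

lemma bounded_linear_map_bound:
  assumes E: "normed_space E" and T: "bounded_linear_map E F T"
  obtains M where "0 \<le> M" "\<And>x. x \<in> pts E \<Longrightarrow> nrm F (T x) \<le> M * nrm E x"
proof -
  have "\<exists>M. \<forall>x\<in>pts E. nrm F (T x) \<le> M * nrm E x"
    using T by (simp add: bounded_linear_map_def)
  then obtain M where M: "\<And>x. x \<in> pts E \<Longrightarrow> nrm F (T x) \<le> M * nrm E x"
    by blast
  show thesis
  proof (rule that[of "\<bar>M\<bar>"])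
    show "nrm F (T x) \<le> \<bar>M\<bar> * nrm E x" if "x \<in> pts E" for x
      using M[OF that] mult_right_mono[OF abs_ge_self nrm_nonneg[OF E that], of M] by linarith
  qed simp
qed

lemma adjoint_map_mem:
  assumes E: "normed_space E" and F: "normed_space F" and T: "bounded_linear_map E F T"
    and g: "g \<in> pts (dual F)"
  shows "adjoint_map E T g \<in> pts (dual E)"
proof -
  obtain M where M: "\<And>x. x \<in> pts E \<Longrightarrow> nrm F (T x) \<le> M * nrm E x"
    using bounded_linear_map_bound[OF E T] by metis
  have Tx: "T x \<in> pts F" if "x \<in> pts E" for x
    using T that by (simp add: bounded_linear_map_def)
  show ?thesis
  proof (rule dual_memI[where M = "nrm (dual F) g * M"])
    fix x y assume xy: "x \<in> pts E" "y \<in> pts E"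
    then have "T (x + y) = T x + T y"
      using T by (simp add: bounded_linear_map_def)
    then show "adjoint_map E T g (x + y) = adjoint_map E T g x + adjoint_map E T g y"
      using xy by (simp add: adjoint_map_def zero_ext_def add_mem[OF E] functional_add[OF g] Tx)
  next
    fix c x assume x: "x \<in> pts E"
    then have "T (scl E c x) = scl F c (T x)"
      using T by (simp add: bounded_linear_map_def)
    then show "adjoint_map E T g (scl E c x) = c * adjoint_map E T g x"
      using x by (simp add: adjoint_map_def zero_ext_def scl_mem[OF E] functional_scl[OF g] Tx)
  next
    fix x assume x: "x \<in> pts E"
    have "norm (g (T x)) \<le> nrm (dual F) g * nrm F (T x)"
      by (rule functional_le[OF F g Tx[OF x]])
    also have "\<dots> \<le> nrm (dual F) g * (M * nrm E x)"
      using M[OF x] nrm_nonneg[OF normed_space_dual[OF F] g] by (rule mult_left_mono)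
    finally show "norm (adjoint_map E T g x) \<le> nrm (dual F) g * M * nrm E x"
      using x by (simp add: adjoint_map_def zero_ext_def mult.assoc)
  qed (simp add: adjoint_map_def zero_ext_def)
qed

text \<open>
  This replaces the open mapping theorem. The functionals \<open>g\<close> whose adjoint image has norm at most
  \<open>1\<close> are bounded at each point \<open>T x\<close> by the norm of \<open>x\<close>, hence pointwise bounded on all of \<open>F\<close> by
  surjectivity, and the uniform boundedness principle applies.
\<close>

lemma adjoint_map_bounded_below:
  fixes E :: "('k::real_or_complex, 'v::ab_group_add) space"
  assumes E: "normed_space E" and F: "banach_space F" and T: "bounded_linear_map E F T"
    and surj: "T ` pts E = pts F"
  obtains C where "0 \<le> C"
    and "\<And>g. g \<in> pts (dual F) \<Longrightarrow> nrm (dual F) g \<le> C * nrm (dual E) (adjoint_map E T g)"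
proof -
  have F': "normed_space F"
    using F by (simp add: banach_space_def)
  note dF = normed_space_dual[OF F'] and dE = normed_space_dual[OF E]
  have T'_le: "norm (g (T x)) \<le> nrm (dual E) (adjoint_map E T g) * nrm E x"
    if "g \<in> pts (dual F)" "x \<in> pts E" for g x
    using functional_le[OF E adjoint_map_mem[OF E F' T that(1)] that(2)] that(2)
    by (simp add: adjoint_map_def zero_ext_def)
  define S where "S = {g \<in> pts (dual F). nrm (dual E) (adjoint_map E T g) \<le> 1}"
  have "\<exists>C. \<forall>g\<in>S. nrm (dual F) g \<le> C"
  proof (rule uniform_boundedness[OF F])
    show "S \<subseteq> pts (dual F)"
      unfolding S_def by blast
    fix y assume "y \<in> pts F"
    then obtain x where x: "x \<in> pts E" "y = T x"
      using surj by blast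
    have "norm (g y) \<le> nrm E x" if "g \<in> S" for g
    proof -
      have "norm (g y) \<le> nrm (dual E) (adjoint_map E T g) * nrm E x"
        using T'_le[of g x] that x by (simp add: S_def)
      also have "\<dots> \<le> 1 * nrm E x"
        using that nrm_nonneg[OF E x(1)] by (intro mult_right_mono) (simp_all add: S_def)
      finally show ?thesis by simp
    qed
    then show "\<exists>C. \<forall>g\<in>S. norm (g y) \<le> C"
      by blast
  qed
  then obtain C where C: "\<And>g. g \<in> S \<Longrightarrow> nrm (dual F) g \<le> C"
    by blast
  show thesis
  proof (rule that[of "\<bar>C\<bar>"])
    fix g assume g: "g \<in> pts (dual F)"
    let ?n = "nrm (dual E) (adjoint_map E T g)"
    have n: "?n \<ge> 0"
      by (rule nrm_nonneg[OF dE adjoint_map_mem[OF E F' T g]])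
    show "nrm (dual F) g \<le> \<bar>C\<bar> * ?n"
    proof (cases "?n = 0")
      \<comment> \<open>here \<open>g\<close> cannot be normalised, but it vanishes on the range of \<open>T\<close>\<close>
      case True
      have "norm (g y) \<le> 0 * nrm F y" if "y \<in> pts F" for y
      proof -
        obtain x where "x \<in> pts E" "y = T x"
          using \<open>y \<in> pts F\<close> surj by blast
        then show ?thesis
          using T'_le[OF g, of x] True by simp
      qed
      then have "nrm (dual F) g \<le> 0"
        by (intro dual_nrm_le[OF F']) auto
      then show ?thesis
        using True by simp
    next
      case False
      then have pos: "?n > 0"
        using n by simp
      let ?c = "of_real (inverse ?n) :: 'k"
      have nc: "norm ?c = inverse ?n"
        unfolding norm_of_real using pos by simp
      have "adjoint_map E T (scl (dual F) ?c g) = scl (dual E) ?c (adjoint_map E T g)"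
        by (auto simp: adjoint_map_def zero_ext_def dual_simps(2))
      then have "nrm (dual E) (adjoint_map E T (scl (dual F) ?c g)) = 1"
        using pos nc by (simp add: nrm_scl[OF dE adjoint_map_mem[OF E F' T g]])
      then have "scl (dual F) ?c g \<in> S"
        unfolding S_def using scl_mem[OF dF g] by simp
      then have "inverse ?n * nrm (dual F) g \<le> \<bar>C\<bar>"
        using C nrm_scl[OF dF g, of ?c] nc by fastforce
      then show ?thesis
        using pos by (simp add: field_simps)
    qed
  qed simp
qed

text \<open>
  The value \<open>\<Lambda> g\<close> is prescribed at the adjoint image of \<open>g\<close>. Since the adjoint is bounded below, this
  is a bounded functional on the range of the adjoint, and any Hahn--Banach extension of it is a
  preimage of \<open>\<Lambda>\<close>.
\<close>

lemma second_adjoint_surj: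
  fixes E :: "('k::real_or_complex, 'v::ab_group_add) space"
    and F :: "('k, 'w::ab_group_add) space"
  assumes E: "normed_space E" and F: "banach_space F" and T: "bounded_linear_map E F T"
    and surj: "T ` pts E = pts F" and \<Lambda>: "\<Lambda> \<in> pts (bidual F)"
  obtains \<psi> where "\<psi> \<in> pts (bidual E)" and "second_adjoint E F T \<psi> = \<Lambda>"
proof -
  have F': "normed_space F"
    using F by (simp add: banach_space_def)
  note dF = normed_space_dual[OF F'] and dE = normed_space_dual[OF E]
  note T'_mem = adjoint_map_mem[OF E F' T]
  obtain C where C: "0 \<le> C"
    "\<And>g. g \<in> pts (dual F) \<Longrightarrow> nrm (dual F) g \<le> C * nrm (dual E) (adjoint_map E T g)"
    using adjoint_map_bounded_below[OF E F T surj] by metis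
  define G where "G = {(adjoint_map E T g, \<Lambda> g) | g. g \<in> pts (dual F)}"
  have mem: "(adjoint_map E T g, \<Lambda> g) \<in> G" if "g \<in> pts (dual F)" for g
    using that unfolding G_def by blast
  have "linear_graph (scl (dual E)) G"
    unfolding linear_graph_def
  proof (intro conjI allI impI)
    have "adjoint_map E T 0 = 0"
      by (auto simp: adjoint_map_def zero_ext_def)
    then show "(0, 0) \<in> G"
      using mem[OF zero_mem[OF dF]] functional_zero[OF dF \<Lambda>] by simp
  next
    fix f t f' t' assume "(f, t) \<in> G \<and> (f', t') \<in> G"
    then obtain g g' where g: "g \<in> pts (dual F)" "f = adjoint_map E T g" "t = \<Lambda> g"
      and g': "g' \<in> pts (dual F)" "f' = adjoint_map E T g'" "t' = \<Lambda> g'"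
      unfolding G_def by blast
    have "adjoint_map E T (g + g') = f + f'"
      unfolding g(2) g'(2) by (auto simp: adjoint_map_def zero_ext_def)
    then show "(f + f', t + t') \<in> G"
      using mem[OF add_mem[OF dF g(1) g'(1)]] functional_add[OF \<Lambda> g(1) g'(1)]
      by (simp add: g(3) g'(3))
  next
    fix c f t assume "(f, t) \<in> G"
    then obtain g where g: "g \<in> pts (dual F)" "f = adjoint_map E T g" "t = \<Lambda> g"
      unfolding G_def by blast
    have "adjoint_map E T (scl (dual F) c g) = scl (dual E) c f"
      unfolding g(2) by (auto simp: adjoint_map_def zero_ext_def dual_simps(2))
    then show "(scl (dual E) c f, c * t) \<in> G"
      using mem[OF scl_mem[OF dF g(1), of c]] functional_scl[OF \<Lambda> g(1), of c] by (simp add: g(3))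
  qed
  moreover have "0 \<le> nrm (bidual F) \<Lambda> * C"
    using C(1) nrm_nonneg[OF normed_space_dual[OF dF] \<Lambda>] by simp
  moreover have "f \<in> pts (dual E) \<and> norm t \<le> nrm (bidual F) \<Lambda> * C * nrm (dual E) f"
    if ft: "(f, t) \<in> G" for f t
  proof -
    obtain g where g: "g \<in> pts (dual F)" "f = adjoint_map E T g" "t = \<Lambda> g"
      using ft unfolding G_def by blast
    have "norm (\<Lambda> g) \<le> nrm (bidual F) \<Lambda> * nrm (dual F) g"
      by (rule functional_le[OF dF \<Lambda> g(1)])
    also have "\<dots> \<le> nrm (bidual F) \<Lambda> * (C * nrm (dual E) f)"
      unfolding g(2) using C(2)[OF g(1)] nrm_nonneg[OF normed_space_dual[OF dF] \<Lambda>]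
      by (rule mult_left_mono)
    finally show ?thesis
      using T'_mem[OF g(1)] g by (simp add: mult.assoc)
  qed
  ultimately obtain \<psi> where \<psi>: "\<psi> \<in> pts (bidual E)" "\<And>f t. (f, t) \<in> G \<Longrightarrow> \<psi> f = t"
    using hahn_banach[OF dE] by blast
  show thesis
  proof (rule that[OF \<psi>(1)], rule ext)
    fix g
    show "second_adjoint E F T \<psi> g = \<Lambda> g"
    proof (cases "g \<in> pts (dual F)")
      case True
      then show ?thesis
        using \<psi>(2)[OF mem[OF True]]
        by (simp add: second_adjoint_def adjoint_map_def[of "dual F"] zero_ext_def)
    next
      case False
      moreover have "\<Lambda> g = 0"
        using \<Lambda> False unfolding dual_simps(1)[of \<Lambda>] by blast
      ultimately show ?thesis
        by (simp add: second_adjoint_def adjoint_map_def[of "dual F"] zero_ext_def)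
    qed
  qed
qed

section \<open>The first Arens product\<close>

lemma arens1_mem:
  assumes A: "banach_algebra A m" and f: "f \<in> pts (dual A)" and a: "a \<in> pts A"
  shows "arens1 A m f a \<in> pts (dual A)"
    and "nrm (dual A) (arens1 A m f a) \<le> nrm (dual A) f * nrm A a"
proof -
  have A': "normed_space A"
    using A by (simp add: banach_algebra_def banach_space_def)
  have m: "m a b \<in> pts A" "m a (b + c) = m a b + m a c" "m a (scl A k b) = scl A k (m a b)"
    if "b \<in> pts A" "c \<in> pts A" for b c k
    using A a that by (simp_all add: banach_algebra_def bounded_bilinear_map_def)
  have le: "norm (arens1 A m f a b) \<le> nrm (dual A) f * nrm A a * nrm A b" if b: "b \<in> pts A" for b
  proof -
    have "norm (f (m a b)) \<le> nrm (dual A) f * nrm A (m a b)"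
      by (rule functional_le[OF A' f m(1)[OF b b]])
    also have "\<dots> \<le> nrm (dual A) f * (nrm A a * nrm A b)"
      using A a b nrm_nonneg[OF normed_space_dual[OF A'] f]
      by (intro mult_left_mono) (simp_all add: banach_algebra_def)
    finally show ?thesis
      using b by (simp add: arens1_def zero_ext_def mult.assoc)
  qed
  show "arens1 A m f a \<in> pts (dual A)"
    by (rule dual_memI[OF _ _ le])
       (simp_all add: arens1_def zero_ext_def add_mem[OF A'] scl_mem[OF A'] m
         functional_add[OF f] functional_scl[OF f])
  show "nrm (dual A) (arens1 A m f a) \<le> nrm (dual A) f * nrm A a"
    using nrm_nonneg[OF normed_space_dual[OF A'] f] nrm_nonneg[OF A' a]
    by (intro dual_nrm_le[OF A' _ le]) simp_all
qed

text \<open>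
  With \<open>\<psi>\<close> and \<open>f\<close> fixed, the product \<open>\<phi> \<psi>\<close> evaluated at \<open>f\<close> is \<open>\<phi>\<close> evaluated at \<open>arens2 A m \<psi> f\<close>. That this
  is an element of the dual, and not of a larger space, is the weak* continuity of the first Arens
  product in its left factor.
\<close>

lemma arens2_mem:
  assumes A: "banach_algebra A m" and \<psi>: "\<psi> \<in> pts (bidual A)" and f: "f \<in> pts (dual A)"
  shows "arens2 A m \<psi> f \<in> pts (dual A)"
proof -
  have A': "normed_space A"
    using A by (simp add: banach_algebra_def banach_space_def)
  note dA = normed_space_dual[OF A']
  have m: "m a b \<in> pts A" "m (a + a') b = m a b + m a' b" "m (scl A k a) b = scl A k (m a b)"
    if "a \<in> pts A" "a' \<in> pts A" "b \<in> pts A" for a a' b k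
    using A that by (simp_all add: banach_algebra_def bounded_bilinear_map_def)
  have add: "arens1 A m f (a + b) = arens1 A m f a + arens1 A m f b"
    if "a \<in> pts A" "b \<in> pts A" for a b
    using that by (auto simp: arens1_def zero_ext_def m functional_add[OF f])
  have scl: "arens1 A m f (scl A c a) = scl (dual A) c (arens1 A m f a)" if "a \<in> pts A" for a c
    using that m(1,3)[OF that that]
    by (auto simp: arens1_def zero_ext_def functional_scl[OF f] dual_simps(2))
  show ?thesis
  proof (rule dual_memI[where M = "nrm (bidual A) \<psi> * nrm (dual A) f"])
    fix a assume a: "a \<in> pts A"
    have "norm (\<psi> (arens1 A m f a)) \<le> nrm (bidual A) \<psi> * nrm (dual A) (arens1 A m f a)"
      by (rule functional_le[OF dA \<psi> arens1_mem(1)[OF A f a]])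
    also have "\<dots> \<le> nrm (bidual A) \<psi> * (nrm (dual A) f * nrm A a)"
      using arens1_mem(2)[OF A f a] nrm_nonneg[OF normed_space_dual[OF dA] \<psi>]
      by (rule mult_left_mono)
    finally show "norm (arens2 A m \<psi> f a) \<le> nrm (bidual A) \<psi> * nrm (dual A) f * nrm A a"
      using a by (simp add: arens2_def zero_ext_def mult.assoc)
  qed (simp_all add: arens2_def zero_ext_def add_mem[OF A'] scl_mem[OF A'] add scl
      functional_add[OF \<psi>] functional_scl[OF \<psi>] arens1_mem(1)[OF A f])
qed

section \<open>Weak*-to-weak continuity\<close>

text \<open>
  Weak*-to-weak continuity holds as soon as composing with each functional of the target gives an
  evaluation at a point of the predual.
\<close>

lemma continuous_map_weak_star_weakI:
  fixes E :: "('k::real_or_complex, 'v::ab_group_add) space"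
    and Y :: "('k, 'w::ab_group_add) space"
  assumes E: "normed_space E"
    and T: "\<And>\<phi>. \<phi> \<in> pts (dual E) \<Longrightarrow> T \<phi> \<in> pts Y"
    and pre: "\<And>\<Lambda>. \<Lambda> \<in> pts (dual Y) \<Longrightarrow> \<exists>x\<in>pts E. \<forall>\<phi>\<in>pts (dual E). \<Lambda> (T \<phi>) = \<phi> x"
  shows "continuous_map (weak_star_topology E) (weak_topology Y) T"
proof -
  have openin: "openin (weak_star_topology E) {\<phi> \<in> pts (dual E). \<phi> x \<in> U}"
    if "x \<in> pts E" "open U" for x U
    unfolding weak_star_topology_def using that
    by (intro topology_generated_by_Basis) blast
  have top: "topspace (weak_star_topology E) = pts (dual E)"
  proof
    show "topspace (weak_star_topology E) \<subseteq> pts (dual E)"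
      unfolding weak_star_topology_def topology_generated_by_topspace by blast
    show "pts (dual E) \<subseteq> topspace (weak_star_topology E)"
      using openin_subset[OF openin[OF zero_mem[OF E] open_UNIV]] by simp
  qed
  show ?thesis
    unfolding weak_topology_def
  proof (rule continuous_on_generated_topo)
    fix V assume "V \<in> {{x \<in> pts Y. f x \<in> U} | f U. f \<in> pts (dual Y) \<and> open U}"
    then obtain \<Lambda> U where V: "V = {y \<in> pts Y. \<Lambda> y \<in> U}" and "\<Lambda> \<in> pts (dual Y)" "open U"
      by blast
    then obtain x where x: "x \<in> pts E" "\<And>\<phi>. \<phi> \<in> pts (dual E) \<Longrightarrow> \<Lambda> (T \<phi>) = \<phi> x"
      using pre by metis
    have "T -` V \<inter> topspace (weak_star_topology E) = {\<phi> \<in> pts (dual E). \<phi> x \<in> U}"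
      unfolding V top using T x(2) by auto
    then show "openin (weak_star_topology E) (T -` V \<inter> topspace (weak_star_topology E))"
      using openin[OF x(1) \<open>open U\<close>] by simp
  next
    have "(0 :: 'w \<Rightarrow> 'k) \<in> pts (dual Y)"
      by (rule dual_memI[where M = 0]) auto
    then have "pts Y \<in> {{x \<in> pts Y. f x \<in> U} | f U. f \<in> pts (dual Y) \<and> open U}"
      by (intro CollectI exI[of _ 0] exI[of _ UNIV]) auto
    then show "T ` topspace (weak_star_topology E)
        \<subseteq> \<Union> {{x \<in> pts Y. f x \<in> U} | f U. f \<in> pts (dual Y) \<and> open U}"
      unfolding top using T by blast
  qed
qed

theorem mainTheorem4:
  fixes A :: "('k::real_or_complex, 'a::ab_group_add) space"
    and X :: "('k, 'x::ab_group_add) space"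
    and m :: "'a \<Rightarrow> 'a \<Rightarrow> 'a"
    and l :: "'a \<Rightarrow> 'x \<Rightarrow> 'x"
    and r :: "'x \<Rightarrow> 'a \<Rightarrow> 'x"
    and L :: "(('a \<Rightarrow> 'k) \<Rightarrow> 'k) \<Rightarrow> (('x \<Rightarrow> 'k) \<Rightarrow> 'k) \<Rightarrow> (('x \<Rightarrow> 'k) \<Rightarrow> 'k)"
    and R :: "(('x \<Rightarrow> 'k) \<Rightarrow> 'k) \<Rightarrow> (('a \<Rightarrow> 'k) \<Rightarrow> 'k) \<Rightarrow> (('x \<Rightarrow> 'k) \<Rightarrow> 'k)"
    and D :: "'a \<Rightarrow> ('x \<Rightarrow> 'k)"
  assumes "banach_algebra A m"
    and "banach_bimodule A m X l r"
    and "bidual_bimodule A m X l r L R"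
    and "derivation A m (dual X) (dual_left X r) (dual_right X l) D"
    and "D ` pts A = pts (dual X)"
    and "derivation (bidual A) (arens A m) (dual (bidual X))
           (dual_left (bidual X) R) (dual_right (bidual X) L)
           (second_adjoint A (dual X) D)"
  shows "\<forall>\<xi>\<in>pts (bidual X).
           continuous_map (weak_star_topology (dual A)) (weak_topology (bidual X)) (\<lambda>\<phi>. R \<xi> \<phi>)"
proof
  fix \<xi> assume \<xi>: "\<xi> \<in> pts (bidual X)"
  have A: "normed_space A" and X: "normed_space X"
    using assms(1,2) by (simp_all add: banach_algebra_def banach_bimodule_def banach_space_def)
  note dA = normed_space_dual[OF A] and dX = normed_space_dual[OF X]
  have D: "bounded_linear_map A (dual X) D"
    using assms(4) by (simp add: derivation_def)
  note D'_mem = adjoint_map_mem[OF A dX D]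
  have R_mem: "R \<xi> \<phi> \<in> pts (bidual X)" and L_mem: "L \<phi> \<xi> \<in> pts (bidual X)"
    if "\<phi> \<in> pts (bidual A)" for \<phi>
    using assms(3) \<xi> that
    by (simp_all add: bidual_bimodule_def banach_bimodule_def bounded_bilinear_map_def)
  let ?D' = "adjoint_map A D"
  let ?D'' = "second_adjoint A (dual X) D"
  have D'': "?D'' \<phi> \<eta> = \<phi> (?D' \<eta>)" if "\<eta> \<in> pts (bidual X)" for \<phi> \<eta>
    using that by (simp add: second_adjoint_def adjoint_map_def[of "bidual X"] zero_ext_def)
  show "continuous_map (weak_star_topology (dual A)) (weak_topology (bidual X)) (\<lambda>\<phi>. R \<xi> \<phi>)"
  proof (rule continuous_map_weak_star_weakI[OF dA R_mem])
    fix \<Lambda> assume "\<Lambda> \<in> pts (dual (bidual X))"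
    then obtain \<psi> where \<psi>: "\<psi> \<in> pts (bidual A)" and \<Lambda>: "?D'' \<psi> = \<Lambda>"
      using second_adjoint_surj[OF A banach_space_dual[OF X] D assms(5)] by metis
    \<comment> \<open>\<open>h\<close> represents \<open>\<phi> \<mapsto> D'' (\<phi> \<psi>) \<xi>\<close>, and \<open>?D' (L \<psi> \<xi>)\<close> represents \<open>\<phi> \<mapsto> (D'' \<phi> \<psi>) \<xi>\<close>\<close>
    define h where "h = arens2 A m \<psi> (?D' \<xi>)"
    have h: "h \<in> pts (dual A)"
      unfolding h_def by (rule arens2_mem[OF assms(1) \<psi> D'_mem[OF \<xi>]])
    have k: "?D' (L \<psi> \<xi>) \<in> pts (dual A)"
      by (rule D'_mem[OF L_mem[OF \<psi>]])
    have "\<Lambda> (R \<xi> \<phi>) = \<phi> (h - ?D' (L \<psi> \<xi>))" if \<phi>: "\<phi> \<in> pts (bidual A)" for \<phi>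
    proof -
      have "?D'' (arens A m \<phi> \<psi>)
          = dual_left (bidual X) R \<phi> (?D'' \<psi>) + dual_right (bidual X) L (?D'' \<phi>) \<psi>"
        using assms(6) \<phi> \<psi> by (simp add: derivation_def)
      then have "?D'' (arens A m \<phi> \<psi>) \<xi> = \<Lambda> (R \<xi> \<phi>) + ?D'' \<phi> (L \<psi> \<xi>)"
        using \<xi> by (simp add: \<Lambda> dual_left_def dual_right_def zero_ext_def)
      moreover have "?D'' (arens A m \<phi> \<psi>) \<xi> = \<phi> h"
        using D''[OF \<xi>] D'_mem[OF \<xi>] by (simp add: arens_def zero_ext_def h_def)
      moreover have "?D'' \<phi> (L \<psi> \<xi>) = \<phi> (?D' (L \<psi> \<xi>))"
        by (rule D''[OF L_mem[OF \<psi>]])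
      ultimately show ?thesis
        using functional_diff[OF dA \<phi> h k] by simp
    qed
    then show "\<exists>f\<in>pts (dual A). \<forall>\<phi>\<in>pts (bidual A). \<Lambda> (R \<xi> \<phi>) = \<phi> f"
      using diff_mem[OF dA h k] by blast
  qed
qed

end
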